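(* Suppose that, as $m\to\infty$, $m^{-1}\mathbb E\mathsf M\to\bar\kappa_1\geq 0$ and $m^{-1}\mathbb E\mathsf S\to\bar s\geq 0$ with $\bar\kappa_1+\bar s<1$, and that $f_1\to\infty$ and $f_1/m\to0$. Then, as $m\to\infty$, $$\mathbb P\Bigl[\frac{f_1}{m-\mathbb E[\mathsf M+\mathsf S]}\,L_i\ge x\Bigr]\to e^{-x},\qquad 1\le i\le f_1,\ x\ge0,$$ and $$\mathbb P[L_i=l]\to\mathbb P[\mathsf L_i=l],\qquad i>f_1,\ l=0,1,2,\dots.$$ Moreover, $m^{-1}M\to\bar\kappa_1$ in probability as $m\to\infty$.
   Context: Model. For each $m\in\mathbb N$ consider $m$ monomers and $f=f(m)\ge1$ filaments with dissociation constants $0<\kappa_1\le\kappa_2\le\dots\le\kappa_f$ (which may depend on $m$). There is a fixed number $K$ of filament classes: $\kappa_i\in\{\varkappa_1,\dots,\varkappa_K\}$ with $\varkappa_1<\dots<\varkappa_K$, and $f_j\ge1$ is the number of filaments $n$ with $\kappa_n=\varkappa_j$, so $f=\sum_{j=1}^K f_j$, $\kappa_1=\varkappa_1$, and $f_1$ is the number of filaments with the smallest dissociation constant. Set $\rho_i=\kappa_1/\kappa_i$ for a filament $i$ and $\varrho_j=\varkappa_1/\varkappa_j$ for a class $j$. The $\varkappa_j$ may vary with $m$, but the ratios $\varrho_1=1>\varrho_2>\dots>\varrho_K>0$ are fixed. Statements about "filament $i$" as $m\to\infty$ refer to an index $i=i(m)\le f(m)$ that belongs to the same class for all $m$ (class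 1 if $1\le i\le f_1$, a fixed class $j\ge2$ if $i>f_1$), so that $\rho_i$, and hence the law of $\mathsf L_i$ below, is constant. Stationary distribution. $(L_1,\dots,L_f)$ is a random vector of nonnegative integers with $$\mathbb P[L_1=l_1,\dots,L_f=l_f]=c_{m,f}^{-1}\,m!\,\frac{\kappa_1^{-l_1}\cdots\kappa_f^{-l_f}}{(m-l_1-\dots-l_f)!},\qquad l_1+\dots+l_f\le m,$$ where $c_{m,f}$ is the normalization constant, and $M=m-L_1-\dots-L_f$. Auxiliary variables. $\mathsf M$ is Poisson with mean $\kappa_1$; for $i>f_1$, $\mathsf L_i$ is geometric with $\mathbb P[\mathsf L_i\ge l]=\rho_i^l$, $l=0,1,\dots$; all are independent. $\mathsf S=\sum_{i>f_1}\mathsf L_i$ ($\mathsf S\equiv0$ if $f_1=f$). All depend on $m$, which is suppressed. *)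

theory Defs
  imports "HOL-Probability.Probability"
begin

text \<open>
  There are \<open>n\<close> filaments, labelled \<open>1, \<dots>, n\<close>, and \<open>k i\<close> is the dissociation constant of
  filament \<open>i\<close>. A vector \<open>(l\<^sub>1, \<dots>, l\<^sub>n)\<close> of filament lengths is a function \<open>nat \<Rightarrow> nat\<close> that
  vanishes outside \<open>{1..n}\<close>.
\<close>

definition filament_count :: "nat \<Rightarrow> (nat \<Rightarrow> real) \<Rightarrow> real \<Rightarrow> nat" where
  "filament_count n k v = card {i \<in> {1..n}. k i = v}"

abbreviation min_count :: "nat \<Rightarrow> (nat \<Rightarrow> real) \<Rightarrow> nat" where
  "min_count n k \<equiv> filament_count n k (k 1)"

definition configs :: "nat \<Rightarrow> nat \<Rightarrow> (nat \<Rightarrow> nat) set" where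
  "configs m n = {l. (\<forall>i. i \<notin> {1..n} \<longrightarrow> l i = 0) \<and> (\<Sum>i=1..n. l i) \<le> m}"

definition config_weight :: "nat \<Rightarrow> nat \<Rightarrow> (nat \<Rightarrow> real) \<Rightarrow> (nat \<Rightarrow> nat) \<Rightarrow> real" where
  "config_weight m n k l =
     fact m * (\<Prod>i=1..n. inverse (k i) ^ l i) / fact (m - (\<Sum>i=1..n. l i))"

definition partition_sum :: "nat \<Rightarrow> nat \<Rightarrow> (nat \<Rightarrow> real) \<Rightarrow> real" where
  "partition_sum m n k = (\<Sum>l\<in>configs m n. config_weight m n k l)"

text \<open>The joint law of \<open>(L\<^sub>1, \<dots>, L\<^sub>n)\<close>; \<open>L\<^sub>i\<close> is the coordinate map \<open>\<lambda>l. l i\<close>.\<close>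

definition stationary_pmf :: "nat \<Rightarrow> nat \<Rightarrow> (nat \<Rightarrow> real) \<Rightarrow> (nat \<Rightarrow> nat) pmf" where
  "stationary_pmf m n k =
     embed_pmf (\<lambda>l. if l \<in> configs m n then config_weight m n k l / partition_sum m n k else 0)"

definition free_monomers :: "nat \<Rightarrow> nat \<Rightarrow> (nat \<Rightarrow> nat) \<Rightarrow> real" where
  "free_monomers m n l = real m - (\<Sum>i=1..n. real (l i))"

text \<open>The geometric law on \<open>{0, 1, \<dots>}\<close> with tail \<open>P(X \<ge> l) = r ^ l\<close>, for \<open>0 < r < 1\<close>.\<close>

definition geometric_tail_pmf :: "real \<Rightarrow> nat pmf" where
  "geometric_tail_pmf r = geometric_pmf (1 - r)"

text \<open>
  Joint law of the independent auxiliary variables. An outcome is a pair: its first component is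
  the Poisson variable, and coordinate \<open>i\<close> of its second component is the geometric
  variable of filament \<open>i\<close>, for \<open>i\<close> beyond the filaments with smallest dissociation constant.
\<close>

definition aux_pmf :: "nat \<Rightarrow> (nat \<Rightarrow> real) \<Rightarrow> (nat \<times> (nat \<Rightarrow> nat)) pmf" where
  "aux_pmf n k =
     pair_pmf (poisson_pmf (k 1))
       (Pi_pmf {min_count n k<..n} 0 (\<lambda>i. geometric_tail_pmf (k 1 / k i)))"

definition aux_M :: "nat \<times> (nat \<Rightarrow> nat) \<Rightarrow> real" where
  "aux_M \<omega> = real (fst \<omega>)"

definition aux_L :: "nat \<Rightarrow> nat \<times> (nat \<Rightarrow> nat) \<Rightarrow> nat" where
  "aux_L i \<omega> = snd \<omega> i"

definition aux_S :: "nat \<Rightarrow> (nat \<Rightarrow> real) \<Rightarrow> nat \<times> (nat \<Rightarrow> nat) \<Rightarrow> real" where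
  "aux_S n k \<omega> = (\<Sum>i\<in>{min_count n k<..n}. real (aux_L i \<omega>))"

lemma finite_configs: "finite (configs m n)"
proof (rule finite_subset)
  show "configs m n \<subseteq> PiE_dflt {1..n} 0 (\<lambda>_. {..m})"
  proof
    fix l assume l: "l \<in> configs m n"
    have "l i \<le> m" if "i \<in> {1..n}" for i
      using member_le_sum[of i "{1..n}" l] that l by (auto simp: configs_def)
    with l show "l \<in> PiE_dflt {1..n} 0 (\<lambda>_. {..m})"
      by (auto simp: configs_def PiE_dflt_def)
  qed
  show "finite (PiE_dflt {1..n} 0 (\<lambda>_. {..m}))"
    by (rule finite_PiE_dflt) auto
qed

lemma pmf_stationary:
  assumes k: "\<And>i. i \<in> {1..n} \<Longrightarrow> 0 < k i"
  shows "pmf (stationary_pmf m n k) l =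
     (if l \<in> configs m n then config_weight m n k l / partition_sum m n k else 0)"
proof -
  have pos: "0 < config_weight m n k l" for l
    unfolding config_weight_def
    by (intro divide_pos_pos mult_pos_pos prod_pos) (auto intro!: zero_less_power k)
  have "(\<lambda>_. 0) \<in> configs m n" by (simp add: configs_def)
  then have Z: "0 < partition_sum m n k"
    unfolding partition_sum_def using finite_configs pos by (intro sum_pos) auto
  define g where
    "g l = (if l \<in> configs m n then config_weight m n k l / partition_sum m n k else 0)" for l
  have g0: "0 \<le> g l" for l
    using pos[of l] Z by (auto simp: g_def)
  have "(\<integral>\<^sup>+l. ennreal (g l) \<partial>count_space UNIV) = (\<Sum>l\<in>configs m n. ennreal (g l))"
    by (rule nn_integral_count_space') (auto simp: finite_configs g_def)
  also have "\<dots> = ennreal (\<Sum>l\<in>configs m n. g l)"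
    using g0 by (simp add: sum_ennreal)
  also have "(\<Sum>l\<in>configs m n. g l) = (\<Sum>l\<in>configs m n. config_weight m n k l) / partition_sum m n k"
    by (simp add: g_def sum_divide_distrib)
  also have "\<dots> = 1" using Z by (simp add: partition_sum_def)
  finally have "pmf (embed_pmf g) l = g l"
    using g0 by (intro pmf_embed_pmf) auto
  then show ?thesis by (simp add: stationary_pmf_def g_def[abs_def])
qed

lemma geometric_tail:
  assumes "0 < r" "r < 1"
  shows "measure_pmf.prob (geometric_tail_pmf r) {l..} = r ^ l"
proof -
  have p: "pmf (geometric_tail_pmf r) i = r ^ i * (1 - r)" for i
    using assms by (simp add: geometric_tail_pmf_def)
  have "(\<Sum>i<l. r ^ i * (1 - r)) = 1 - r ^ l"
    by (induction l) (auto simp: algebra_simps)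
  then have "measure_pmf.prob (geometric_tail_pmf r) {..<l} = 1 - r ^ l"
    by (simp add: measure_measure_pmf_finite p)
  moreover have "{l..} = space (measure_pmf (geometric_tail_pmf r)) - {..<l}" by auto
  ultimately show ?thesis
    using measure_pmf.prob_compl[of "{..<l}" "geometric_tail_pmf r"] by simp
qed

lemma map_aux_L:
  assumes "i \<in> {min_count n k<..n}"
  shows "map_pmf (aux_L i) (aux_pmf n k) = geometric_tail_pmf (k 1 / k i)"
proof -
  have "aux_L i = (\<lambda>h. h i) \<circ> snd" by (auto simp: aux_L_def)
  then show ?thesis
    using assms
    by (simp add: aux_pmf_def pmf.map_comp[symmetric] map_snd_pair_pmf Pi_pmf_component)
qed

end

theory Submission
  imports Defs
begin

text \<open>
  Let \<open>Z N\<close> be the coefficient of \<open>z\<^sup>N\<close> in \<open>exp (\<kappa>\<^sub>1 z) \<cdot> (\<Prod>i. 1 / (1 - \<rho>\<^sub>i z))\<close>. Removing \<open>a\<close> monomers from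
  filament \<open>i\<close> gives \<open>P(L\<^sub>i \<ge> a) = \<rho>\<^sub>i\<^sup>a Z (m - a) / Z m\<close>, and the factorial moments of \<open>M\<close> are
  \<open>\<kappa>\<^sub>1\<^sup>s Z (m - s) / Z m\<close>. So all three claims follow once \<open>Z (m - a) / Z m\<close> tends to \<open>exp (- x)\<close>
  whenever \<open>a f\<^sub>1 / (m - E(M + S))\<close> tends to \<open>x\<close>.

  The ratios \<open>q N = Z N / Z (N + 1)\<close> increase with \<open>N\<close>, because log-concavity is preserved by
  convolution with geometric sequences. Since the mass \<open>M + L\<^sub>1 + \<dots> + L\<^sub>f = N\<close> is conserved in mean,
  monotonicity squeezes \<open>1 - q m\<close> between two bounds asymptotic to \<open>f\<^sub>1 / (m - E(M + S))\<close>.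
\<close>

section \<open>The reduced partition function\<close>

text \<open>
  For \<open>u = \<kappa>\<^sub>1\<close> and \<open>r\<^sub>i = \<kappa>\<^sub>1 / \<kappa>\<^sub>i\<close> this is proportional to \<^const>\<open>config_weight\<close>, with a factor that
  depends only on the total mass \<open>N\<close>.
\<close>

definition reduced_weight :: "real \<Rightarrow> (nat \<Rightarrow> real) \<Rightarrow> nat \<Rightarrow> nat \<Rightarrow> (nat \<Rightarrow> nat) \<Rightarrow> real" where
  "reduced_weight u r n N l =
     (\<Prod>i=1..n. r i ^ l i) * u ^ (N - (\<Sum>i=1..n. l i)) / fact (N - (\<Sum>i=1..n. l i))"

definition reduced_sum :: "real \<Rightarrow> (nat \<Rightarrow> real) \<Rightarrow> nat \<Rightarrow> nat \<Rightarrow> real" where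
  "reduced_sum u r n N = (\<Sum>l\<in>configs N n. reduced_weight u r n N l)"

section \<open>Adding and removing monomers at one filament\<close>

lemma configs_add_filament:
  assumes "i \<in> {1..n}"
  shows "l(i := l i + a) \<in> configs (N + a) n \<longleftrightarrow> l \<in> configs N n"
    and "(\<Sum>j=1..n. (l(i := l i + a)) j) = (\<Sum>j=1..n. l j) + a"
proof -
  have "(\<Sum>j=1..n. (l(i := l i + a)) j) = (\<Sum>j=1..n. l j + (if j = i then a else 0))"
    by (rule sum.cong) auto
  also have "\<dots> = (\<Sum>j=1..n. l j) + a"
    using assms by (simp add: sum.distrib)
  finally show "(\<Sum>j=1..n. (l(i := l i + a)) j) = (\<Sum>j=1..n. l j) + a" .
  then show "l(i := l i + a) \<in> configs (N + a) n \<longleftrightarrow> l \<in> configs N n"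
    using assms unfolding configs_def by auto
qed

lemma reduced_weight_add_filament:
  assumes "i \<in> {1..n}"
  shows "reduced_weight u r n (N + a) (l(i := l i + a)) = r i ^ a * reduced_weight u r n N l"
proof -
  have "(\<Prod>j=1..n. r j ^ (l(i := l i + a)) j) = (\<Prod>j=1..n. r j ^ l j * (if j = i then r i ^ a else 1))"
    by (rule prod.cong) (auto simp: power_add)
  also have "\<dots> = (\<Prod>j=1..n. r j ^ l j) * r i ^ a"
    using assms by (simp add: prod.distrib)
  finally show ?thesis
    unfolding reduced_weight_def configs_add_filament(2)[OF assms] by simp
qed

text \<open>Removing \<open>a\<close> monomers from filament \<open>i\<close> is a bijection onto
  \<open>configs (N - a) n\<close>. The number of free monomers
  \<open>N - (\<Sum>i=1..n. l i)\<close> stays the same, so the weight only loses the factor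
  \<open>r i ^ a\<close>.\<close>

lemma sum_reduced_weight_tail:
  assumes i: "i \<in> {1..n}" and "a \<le> N"
  shows "(\<Sum>l\<in>{l \<in> configs N n. a \<le> l i}. reduced_weight u r n N l)
           = r i ^ a * reduced_sum u r n (N - a)"
proof -
  have "(\<Sum>l\<in>{l \<in> configs N n. a \<le> l i}. reduced_weight u r n N l) =
        (\<Sum>l\<in>configs (N - a) n. r i ^ a * reduced_weight u r n (N - a) l)"
  proof (rule sum.reindex_bij_witness[where i = "\<lambda>l. l(i := l i + a)" and j = "\<lambda>l. l(i := l i - a)"])
    fix l assume l: "l \<in> {l \<in> configs N n. a \<le> l i}"
    then have eq: "(l(i := l i - a))(i := (l(i := l i - a)) i + a) = l" by auto
    then show "(l(i := l i - a))(i := (l(i := l i - a)) i + a) = l" .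
    show "l(i := l i - a) \<in> configs (N - a) n"
      using configs_add_filament(1)[OF i, of "l(i := l i - a)" a "N - a"] l \<open>a \<le> N\<close> eq by simp
    show "r i ^ a * reduced_weight u r n (N - a) (l(i := l i - a)) = reduced_weight u r n N l"
      using reduced_weight_add_filament[OF i, of u r "N - a" a "l(i := l i - a)"] \<open>a \<le> N\<close> eq by simp
  next
    fix l assume "l \<in> configs (N - a) n"
    then show "l(i := l i + a) \<in> {l \<in> configs N n. a \<le> l i}"
      using configs_add_filament(1)[OF i, of l a "N - a"] \<open>a \<le> N\<close> by simp
  qed auto
  then show ?thesis by (simp add: reduced_sum_def sum_distrib_left)
qed

lemma configs_le:
  assumes "l \<in> configs N n"
  shows "l i \<le> N"
proof (cases "i \<in> {1..n}")
  case True
  then show ?thesis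
    using member_le_sum[of i "{1..n}" l] assms by (auto simp: configs_def)
qed (use assms in \<open>auto simp: configs_def\<close>)

section \<open>Recursion in the number of filaments\<close>

lemma reduced_sum_no_filaments: "reduced_sum u r 0 N = u ^ N / fact N"
proof -
  have "configs N 0 = {\<lambda>_. 0}" by (auto simp: configs_def)
  then show ?thesis by (simp add: reduced_sum_def reduced_weight_def)
qed

lemma reduced_sum_new_filament_0: "reduced_sum u r (Suc n) 0 = reduced_sum u r n 0"
proof -
  have "configs 0 n = {\<lambda>_. 0}" for n
    by (auto simp: configs_def fun_eq_iff) (metis atLeastAtMost_iff not_less_eq_eq)
  then show ?thesis by (simp add: reduced_sum_def reduced_weight_def)
qed

text \<open>Either the new filament is empty or one monomer can be removed from it. This is the
  coefficient form of multiplying the generating function by \<open>1 / (1 - r (Suc n) z)\<close>,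
  and it drives the induction on \<open>n\<close>.\<close>

lemma reduced_sum_new_filament_Suc:
  "reduced_sum u r (Suc n) (Suc N) = reduced_sum u r n (Suc N) + r (Suc n) * reduced_sum u r (Suc n) N"
proof -
  let ?C = "configs (Suc N) (Suc n)"
  have "?C = {l \<in> ?C. l (Suc n) = 0} \<union> {l \<in> ?C. 1 \<le> l (Suc n)}"
    and "{l \<in> ?C. l (Suc n) = 0} \<inter> {l \<in> ?C. 1 \<le> l (Suc n)} = {}" by auto
  then have "reduced_sum u r (Suc n) (Suc N) =
    (\<Sum>l\<in>{l \<in> ?C. l (Suc n) = 0}. reduced_weight u r (Suc n) (Suc N) l) +
    (\<Sum>l\<in>{l \<in> ?C. 1 \<le> l (Suc n)}. reduced_weight u r (Suc n) (Suc N) l)"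
    unfolding reduced_sum_def
    by (metis (no_types, lifting) finite_Un finite_configs sum.union_disjoint)
  \<comment> \<open>Configurations vanish outside their index range, so an empty last filament gives
    literally a configuration of \<open>n\<close> filaments.\<close>
  also have "{l \<in> ?C. l (Suc n) = 0} = configs (Suc N) n"
    by (auto simp: configs_def) (metis le_SucE atLeastAtMost_iff)
  also have "(\<Sum>l\<in>configs (Suc N) n. reduced_weight u r (Suc n) (Suc N) l) = reduced_sum u r n (Suc N)"
    unfolding reduced_sum_def
    by (rule sum.cong) (auto simp: reduced_weight_def configs_def)
  finally show ?thesis
    using sum_reduced_weight_tail[of "Suc n" "Suc n" 1 "Suc N" u r] by simp
qed

lemma reduced_sum_pos:
  assumes "0 < u" "\<And>i. i \<in> {1..n} \<Longrightarrow> 0 < r i"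
  shows "0 < reduced_sum u r n N"
proof -
  have "(\<lambda>_. 0) \<in> configs N n" by (simp add: configs_def)
  then show ?thesis
    unfolding reduced_sum_def reduced_weight_def using finite_configs assms
    by (intro sum_pos divide_pos_pos mult_pos_pos prod_pos) (auto intro!: zero_less_power)
qed

text \<open>The auxiliary ratio \<open>s N = w N / z (Suc N)\<close> satisfies a recursion that is
  increasing both in \<open>s\<close> and in the ratios of \<open>z\<close>, so \<open>s\<close>
  increases by induction. The ratio of \<open>w\<close> is \<open>s / (1 + \<rho> * s)\<close>, an
  increasing function of \<open>s\<close>.\<close>

lemma incseq_ratio_geometric_convolution:
  fixes z w :: "nat \<Rightarrow> real"
  assumes z_pos: "\<And>N. 0 < z N" and w_pos: "\<And>N. 0 < w N" and \<rho>: "0 \<le> \<rho>"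
    and w0: "w 0 = z 0" and wSuc: "\<And>N. w (Suc N) = z (Suc N) + \<rho> * w N"
    and mono: "incseq (\<lambda>N. z N / z (Suc N))"
  shows "incseq (\<lambda>N. w N / w (Suc N))"
proof -
  define s where "s N = w N / z (Suc N)" for N
  have s_nonneg: "0 \<le> s N" for N
    unfolding s_def using z_pos w_pos by (simp add: less_imp_le)
  have s_Suc: "s (Suc N) = (1 + \<rho> * s N) * (z (Suc N) / z (Suc (Suc N)))" for N
    using z_pos[of "Suc N"] by (simp add: s_def wSuc divide_simps)
  have step: "z N / z (Suc N) \<le> z (Suc N) / z (Suc (Suc N))" for N
    using incseq_SucD[OF mono] .
  have s_mono: "s N \<le> s (Suc N)" for N
  proof (induction N)
    case 0
    have "s 0 \<le> 1 * (z 1 / z 2)"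
      using step[of 0] by (simp add: s_def w0 numeral_2_eq_2)
    also have "\<dots> \<le> s (Suc 0)"
      unfolding s_Suc using \<rho> s_nonneg z_pos
      by (intro mult_mono) (auto simp: numeral_2_eq_2 less_imp_le)
    finally show ?case .
  next
    case (Suc N)
    show ?case
      unfolding s_Suc[of "Suc N"] using Suc step[of "Suc N"] \<rho> s_nonneg z_pos
      by (subst s_Suc, intro mult_mono add_mono) (auto simp: less_imp_le mult_left_mono)
  qed
  have ratio: "w N / w (Suc N) = s N / (1 + \<rho> * s N)" for N
    using z_pos[of "Suc N"] w_pos[of N] \<rho> by (simp add: s_def wSuc divide_simps)
  show ?thesis
  proof (rule incseq_SucI)
    fix N
    have "0 < 1 + \<rho> * s N" for N
      using \<rho> s_nonneg[of N] by (simp add: add_pos_nonneg)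
    then show "w N / w (Suc N) \<le> w (Suc N) / w (Suc (Suc N))"
      unfolding ratio using s_mono[of N] by (simp add: divide_simps algebra_simps)
  qed
qed

text \<open>Without filaments the ratio is \<open>(N + 1) / u\<close>, and each new filament is a
  geometric convolution.\<close>

lemma incseq_reduced_sum_ratio:
  assumes "0 < u" "\<And>i. i \<in> {1..n} \<Longrightarrow> 0 < r i"
  shows "incseq (\<lambda>N. reduced_sum u r n N / reduced_sum u r n (Suc N))"
  using assms(2)
proof (induction n)
  case 0
  have "u ^ N / fact N / (u ^ Suc N / fact (Suc N)) = real (Suc N) / u" for N
    using assms(1) by (simp add: divide_simps)
  then show ?case
    using assms(1) by (auto simp: reduced_sum_no_filaments incseq_def divide_right_mono)
next
  case (Suc n)
  show ?case
  proof (rule incseq_ratio_geometric_convolution)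
    show "incseq (\<lambda>N. reduced_sum u r n N / reduced_sum u r n (Suc N))"
      using Suc by simp
    show "0 \<le> r (Suc n)" using Suc.prems[of "Suc n"] by simp
  qed (use assms(1) Suc.prems in
    \<open>auto simp: reduced_sum_new_filament_0 reduced_sum_new_filament_Suc intro!: reduced_sum_pos\<close>)
qed

text \<open>The factor \<open>free_monomers\<close> cancels one factor of the factorial and releases
  one \<open>u\<close>; configurations without free monomers contribute 0, which leaves
  \<open>configs N n\<close>. The arbitrary \<open>h\<close> allows a second application, for the
  second factorial moment.\<close>

lemma sum_free_reduced_weight:
  "(\<Sum>l\<in>configs (Suc N) n. free_monomers (Suc N) n l * h l * reduced_weight u r n (Suc N) l)
     = u * (\<Sum>l\<in>configs N n. h l * reduced_weight u r n N l)"
proof -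
  let ?F = "\<lambda>l. free_monomers (Suc N) n l * h l * reduced_weight u r n (Suc N) l"
  have "sum ?F (configs (Suc N) n) = sum ?F (configs N n)"
  proof (rule sum.mono_neutral_right)
    show "\<forall>l\<in>configs (Suc N) n - configs N n. ?F l = 0"
    proof
      fix l assume "l \<in> configs (Suc N) n - configs N n"
      then have "(\<Sum>i=1..n. l i) = Suc N" by (auto simp: configs_def)
      then have "free_monomers (Suc N) n l = 0"
        unfolding free_monomers_def by (metis of_nat_sum right_minus_eq)
      then show "?F l = 0" by simp
    qed
    show "configs N n \<subseteq> configs (Suc N) n" by (auto simp: configs_def)
  qed (rule finite_configs)
  also have "\<dots> = (\<Sum>l\<in>configs N n. u * (h l * reduced_weight u r n N l))"
  proof (rule sum.cong)
    fix l assume l: "l \<in> configs N n"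
    let ?s = "\<Sum>i=1..n. l i"
    have s: "?s \<le> N" using l by (simp add: configs_def)
    have "free_monomers (Suc N) n l = real (Suc (N - ?s))"
      unfolding free_monomers_def using s by (simp add: of_nat_diff)
    then show "?F l = u * (h l * reduced_weight u r n N l)"
      using s by (simp add: reduced_weight_def Suc_diff_le del: of_nat_Suc of_nat_sum)
  qed simp
  finally show ?thesis by (simp add: sum_distrib_left)
qed

text \<open>Mass conservation \<open>N = M + L\<^sub>1 + \<dots> + L\<^sub>n\<close>, averaged over the configurations.\<close>

lemma reduced_sum_mass_balance:
  "real (Suc N) * reduced_sum u r n (Suc N) = u * reduced_sum u r n N
     + (\<Sum>i=1..n. \<Sum>a=1..Suc N. r i ^ a * reduced_sum u r n (Suc N - a))"
proof -
  let ?C = "configs (Suc N) n" and ?W = "reduced_weight u r n (Suc N)"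
  have "(\<Sum>a=1..Suc N. r i ^ a * reduced_sum u r n (Suc N - a)) = (\<Sum>l\<in>?C. real (l i) * ?W l)"
    if i: "i \<in> {1..n}" for i
  proof -
    \<comment> \<open>The length \<open>l i\<close> is counted as the number of \<open>a\<close>
      with \<open>1 \<le> a \<le> l i\<close>, which turns tail weights into a weighted mean. No
      length exceeds \<open>Suc N\<close>, so the range of \<open>a\<close> cuts nothing
      off.\<close>
    have "(\<Sum>a=1..Suc N. r i ^ a * reduced_sum u r n (Suc N - a)) =
          (\<Sum>a=1..Suc N. \<Sum>l\<in>?C. (if a \<le> l i then 1 else 0) * ?W l)"
      by (rule sum.cong)
         (auto simp: sum_reduced_weight_tail[OF i, symmetric] finite_configs sum.inter_filter intro!: sum.cong)
    also have "\<dots> = (\<Sum>l\<in>?C. (\<Sum>a=1..Suc N. if a \<le> l i then 1 else 0) * ?W l)"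
      by (subst sum.swap) (simp add: sum_distrib_right del: sum.cl_ivl_Suc)
    also have "\<dots> = (\<Sum>l\<in>?C. real (l i) * ?W l)"
    proof (rule sum.cong)
      fix l assume "l \<in> ?C"
      then have "{1..Suc N} \<inter> {a. a \<le> l i} = {1..l i}" using configs_le[of l "Suc N" n i] by auto
      then show "(\<Sum>a=1..Suc N. if a \<le> l i then 1 else 0) * ?W l = real (l i) * ?W l"
        by (subst sum.inter_restrict[symmetric, where B = "{a. a \<le> l i}", simplified]) auto
    qed simp
    finally show ?thesis .
  qed
  then have "(\<Sum>i=1..n. \<Sum>a=1..Suc N. r i ^ a * reduced_sum u r n (Suc N - a))
      = (\<Sum>l\<in>?C. (\<Sum>i=1..n. real (l i)) * ?W l)"
    by (simp add: sum_distrib_right sum.swap[of _ "configs (Suc N) n"] del: sum.cl_ivl_Suc)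
  moreover have "u * reduced_sum u r n N = (\<Sum>l\<in>?C. free_monomers (Suc N) n l * ?W l)"
    using sum_free_reduced_weight[of N n "\<lambda>_. 1" u r] by (simp add: reduced_sum_def)
  ultimately show ?thesis
    by (simp add: reduced_sum_def free_monomers_def sum_distrib_left flip: sum.distrib distrib_right)
qed

section \<open>Bounds on consecutive ratios\<close>

text \<open>One system with a fixed number of monomers left open; the first \<open>p\<close>
  filaments are those with ratio 1. The separate bound \<open>R\<close> on the other ratios can be
  kept independent of the system, so that geometric tails can later be controlled uniformly.\<close>

locale filament_system =
  fixes u :: real and r :: "nat \<Rightarrow> real" and n p :: nat and R :: real
  assumes u_pos: "0 < u" and p: "1 \<le> p" "p \<le> n"
    and r_min: "\<And>i. i \<in> {1..p} \<Longrightarrow> r i = 1"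
    and r_other: "\<And>i. i \<in> {p<..n} \<Longrightarrow> 0 < r i \<and> r i \<le> R"
    and R: "0 < R" "R < 1"
begin

abbreviation Z :: "nat \<Rightarrow> real" where
  "Z \<equiv> reduced_sum u r n"

text \<open>Since \<open>r 1 = 1\<close>, this is the probability that filament 1 is nonempty in the
  system with \<open>Suc N\<close> monomers.\<close>

definition q :: "nat \<Rightarrow> real" where
  "q N = Z N / Z (Suc N)"

text \<open>The mean of the unconstrained mass \<open>M + S\<close>.\<close>

definition load :: real where
  "load = u + (\<Sum>i\<in>{p<..n}. r i / (1 - r i))"

lemma r_pos: "i \<in> {1..n} \<Longrightarrow> 0 < r i"
  using r_min[of i] r_other[of i] by (cases "i \<le> p") auto

lemma r_lt_1: "i \<in> {p<..n} \<Longrightarrow> r i < 1"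
  using r_other[of i] R by auto

lemma load_pos: "0 < load"
proof -
  have "0 \<le> (\<Sum>i\<in>{p<..n}. r i / (1 - r i))"
  proof (rule sum_nonneg)
    fix i assume "i \<in> {p<..n}"
    then show "0 \<le> r i / (1 - r i)" using r_other[of i] r_lt_1[of i] by simp
  qed
  then show ?thesis unfolding load_def using u_pos by linarith
qed

lemma Z_pos: "0 < Z N"
  using reduced_sum_pos[OF u_pos r_pos] .

lemma Z_Suc_mult_q: "Z (Suc N) * q N = Z N"
  using Z_pos[of "Suc N"] by (simp add: q_def)

lemma q_pos: "0 < q N"
  using Z_pos by (simp add: q_def)

lemma q_mono: "M \<le> N \<Longrightarrow> q M \<le> q N"
  using incseq_reduced_sum_ratio[OF u_pos r_pos] by (auto simp: q_def incseq_def)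

text \<open>\<open>Z N\<close> is the part of \<open>Z (Suc N)\<close> carried by the configurations
  in which filament 1 is nonempty.\<close>

lemma q_le_1: "q N \<le> 1"
proof -
  have "Z N = (\<Sum>l\<in>{l \<in> configs (Suc N) n. 1 \<le> l 1}. reduced_weight u r n (Suc N) l)"
    using sum_reduced_weight_tail[of 1 n 1 "Suc N" u r] p r_min[of 1] by simp
  also have "\<dots> \<le> Z (Suc N)"
    unfolding reduced_sum_def reduced_weight_def using u_pos r_pos finite_configs
    by (intro sum_mono2) (auto intro!: mult_nonneg_nonneg divide_nonneg_nonneg prod_nonneg simp: less_imp_le)
  finally show ?thesis using Z_pos[of "Suc N"] by (simp add: q_def)
qed

lemma Z_mono: "M \<le> N \<Longrightarrow> Z M \<le> Z N"
proof (rule lift_Suc_mono_le)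
  show "Z N \<le> Z (Suc N)" for N
    using q_le_1[of N] Z_pos[of "Suc N"] by (simp add: q_def)
qed

text \<open>The quotient \<open>Z (Suc N - a) / Z (Suc N)\<close> telescopes into \<open>a\<close>
  consecutive values of \<open>q\<close>, the largest of which is \<open>q N\<close>. In
  \<open>Z_diff_ge\<close> the window of indices starts at \<open>N\<close>, so there
  \<open>q N\<close> is the smallest.\<close>

lemma Z_diff_le: "a \<le> Suc N \<Longrightarrow> Z (Suc N - a) \<le> q N ^ a * Z (Suc N)"
proof (induction a)
  case (Suc a)
  then have "Z (Suc N - Suc a) = q (N - a) * Z (Suc N - a)"
    using Z_Suc_mult_q[of "N - a"] by (simp add: Suc_diff_le mult.commute)
  also have "\<dots> \<le> q N * (q N ^ a * Z (Suc N))"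
    using Suc q_pos[of N] Z_pos by (intro mult_mono q_mono) (auto simp: less_imp_le)
  finally show ?case by (simp add: mult_ac)
qed simp

lemma Z_diff_ge: "q N ^ a * Z (N + a) \<le> Z N"
proof (induction a)
  case (Suc a)
  have "q N ^ Suc a * Z (N + Suc a) = q N ^ a * (Z (Suc (N + a)) * q N)"
    by (simp add: mult_ac)
  also have "\<dots> \<le> q N ^ a * (Z (Suc (N + a)) * q (N + a))"
    using q_pos[of N] Z_pos by (intro mult_left_mono q_mono) (auto simp: less_imp_le)
  also have "\<dots> \<le> Z N"
    using Suc by (simp add: Z_Suc_mult_q)
  finally show ?case .
qed simp

section \<open>Mass balance and two-sided control of \<open>1 - q N\<close>\<close>

lemma sum_filaments:
  "(\<Sum>i=1..n. h (r i)) = real p * h 1 + (\<Sum>i\<in>{p<..n}. h (r i))"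
proof -
  have "{1..n} = {1..p} \<union> {p<..n}" using p by auto
  then have "(\<Sum>i=1..n. h (r i)) = (\<Sum>i=1..p. h (r i)) + (\<Sum>i\<in>{p<..n}. h (r i))"
    by (simp only:) (rule sum.union_disjoint, auto)
  then show ?thesis by (simp add: r_min)
qed

lemma mass_balance:
  "real (Suc N) = u * q N + real p * (\<Sum>a=1..Suc N. Z (Suc N - a) / Z (Suc N))
     + (\<Sum>i\<in>{p<..n}. \<Sum>a=1..Suc N. r i ^ a * (Z (Suc N - a) / Z (Suc N)))"
proof -
  have "real (Suc N) = real (Suc N) * Z (Suc N) / Z (Suc N)"
    using Z_pos[of "Suc N"] by simp
  also have "\<dots> = u * q N + (\<Sum>i=1..n. \<Sum>a=1..Suc N. r i ^ a * (Z (Suc N - a) / Z (Suc N)))"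
    unfolding reduced_sum_mass_balance
    by (simp only: q_def add_divide_distrib sum_divide_distrib times_divide_eq_right)
  finally show ?thesis
    by (subst (asm) sum_filaments[of "\<lambda>x. \<Sum>a=1..Suc N. x ^ a * (Z (Suc N - a) / Z (Suc N))"])
       (simp only: power_one mult_1 add.assoc)
qed

lemma sum_power_from_1:
  fixes x :: real
  shows "(1 - x) * (\<Sum>a=1..N. x ^ a) = x * (1 - x ^ N)"
  by (cases "N = 0") (simp_all add: sum_gp_multiplied right_diff_distrib)

text \<open>In the mass balance, the free monomers and the filaments beyond \<open>p\<close> carry
  at most \<open>load\<close>, because all ratios of \<open>Z\<close> are at most 1. The first
  \<open>p\<close> filaments must carry the rest, but each carries at most a geometric sum in
  \<open>q N\<close>. The product form avoids a division by \<open>1 - q N\<close>, which is only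
  known to be nonnegative.\<close>

lemma q_deficit_le:
  assumes "load < Suc N"
  shows "(Suc N - load) * (1 - q N) \<le> p * q N"
proof -
  have ratio: "Z (Suc N - a) / Z (Suc N) \<le> q N ^ a" if "a \<in> {1..Suc N}" for a
    using Z_diff_le[of a N] that Z_pos[of "Suc N"] by (simp add: divide_le_eq)
  have "(\<Sum>a=1..Suc N. r i ^ a * (Z (Suc N - a) / Z (Suc N))) \<le> r i / (1 - r i)"
    if i: "i \<in> {p<..n}" for i
  proof -
    have "0 < r i" "r i < 1" using r_other[OF i] r_lt_1[OF i] by auto
    have "(\<Sum>a=1..Suc N. r i ^ a * (Z (Suc N - a) / Z (Suc N))) \<le> (\<Sum>a=1..Suc N. r i ^ a * 1)"
      using ratio \<open>0 < r i\<close> Z_mono Z_pos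
      by (intro sum_mono mult_left_mono) (auto simp: divide_le_eq_1)
    also have "\<dots> \<le> r i / (1 - r i)"
      proof -
        have "(1 - r i) * (\<Sum>a=1..Suc N. r i ^ a * 1) \<le> r i"
          unfolding mult_1_right sum_power_from_1 using \<open>0 < r i\<close> by (intro mult_left_le) auto
        then show ?thesis using \<open>r i < 1\<close> by (simp only: pos_le_divide_eq diff_gt_0_iff_gt mult.commute)
      qed
    finally show ?thesis .
  qed
  then have "(\<Sum>i\<in>{p<..n}. \<Sum>a=1..Suc N. r i ^ a * (Z (Suc N - a) / Z (Suc N)))
      \<le> (\<Sum>i\<in>{p<..n}. r i / (1 - r i))" by (rule sum_mono)
  moreover have "u * q N \<le> u" using u_pos q_le_1[of N] by simp
  moreover have "real p * (\<Sum>a=1..Suc N. Z (Suc N - a) / Z (Suc N)) \<le> real p * (\<Sum>a=1..Suc N. q N ^ a)"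
    by (intro mult_left_mono sum_mono ratio) auto
  ultimately have "Suc N - load \<le> p * (\<Sum>a=1..Suc N. q N ^ a)"
    using mass_balance[of N] unfolding load_def by linarith
  then have "(Suc N - load) * (1 - q N) \<le> p * (\<Sum>a=1..Suc N. q N ^ a) * (1 - q N)"
    using q_le_1[of N] by (intro mult_right_mono) auto
  also have "\<dots> = p * ((1 - q N) * (\<Sum>a=1..Suc N. q N ^ a))" by (simp only: mult_ac)
  also have "\<dots> \<le> p * q N"
    unfolding sum_power_from_1 using q_pos[of N] by (intro mult_left_mono mult_left_le) auto
  finally show ?thesis .
qed

text \<open>\<open>q_deficit_le\<close> rearranges to
  \<open>1 / q N \<le> 1 + p / (Suc N - load)\<close>, and \<open>1 + t \<le> exp t\<close>.\<close>

lemma q_ge_exp: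
  assumes "load < Suc N"
  shows "exp (- (p / (Suc N - load))) \<le> q N"
proof -
  let ?t = "p / (Suc N - load)"
  have D: "0 < Suc N - load" using assms by simp
  have "Suc N - load \<le> q N * (Suc N - load + p)"
    using q_deficit_le[OF assms] by (simp add: algebra_simps)
  then have "1 \<le> q N * (1 + ?t)"
    using D by (simp add: field_simps)
  also have "\<dots> \<le> q N * exp ?t"
    using q_pos[of N] exp_ge_add_one_self[of ?t] by (intro mult_left_mono) auto
  finally show ?thesis by (simp add: exp_minus field_simps)
qed

text \<open>Among the \<open>a\<close> ratios multiplied here the smallest is
  \<open>q (N - a)\<close>, so \<open>q_ge_exp\<close> is applied at that index; its denominator
  exceeds \<open>N - real a - load\<close> by 1.\<close>

lemma Z_ratio_ge_exp:
  assumes "a \<le> N" "load < N - real a"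
  shows "exp (- (a * p / (N - real a - load))) \<le> Z (N - a) / Z N"
proof -
  let ?D = "N - real a - load"
  have "exp (- (p / ?D)) \<le> exp (- (p / (Suc (N - a) - load)))"
    using assms by (intro iffD2[OF exp_le_cancel_iff] le_imp_neg_le divide_left_mono mult_pos_pos) (auto simp: of_nat_diff)
  also have "\<dots> \<le> q (N - a)"
    using assms by (intro q_ge_exp) (auto simp: of_nat_diff)
  finally have "exp (- (p / ?D)) ^ a \<le> q (N - a) ^ a"
    by (intro power_mono) auto
  also have "\<dots> \<le> Z (N - a) / Z N"
    using Z_diff_ge[of "N - a" a] Z_pos[of N] assms by (simp add: le_divide_eq)
  finally show ?thesis
    by (simp flip: exp_of_nat_mult)
qed

lemma Z_ratio_le_exp:
  assumes "a \<le> Suc N"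
  shows "Z (Suc N - a) / Z (Suc N) \<le> exp (- (a * (1 - q N)))"
proof -
  have "Z (Suc N - a) / Z (Suc N) \<le> q N ^ a"
    using Z_diff_le[OF assms] Z_pos[of "Suc N"] by (simp add: divide_le_eq)
  also have "\<dots> \<le> exp (- (1 - q N)) ^ a"
    using q_pos[of N] exp_ge_add_one_self[of "- (1 - q N)"] by (intro power_mono) auto
  also have "\<dots> = exp (- (a * (1 - q N)))"
    by (simp only: exp_of_nat_mult[symmetric] mult_minus_right)
  finally show ?thesis .
qed

text \<open>
  The mass balance is taken at \<open>Suc N + A\<close>, so that the \<open>A\<close> ratios below that index are all
  at least \<open>q N\<close>.
\<close>

lemma q_deficit_ge:
  fixes A B N :: nat
  assumes "1 \<le> B" "B \<le> Suc N + A"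
  defines "g \<equiv> Z (Suc N + A - B) / Z (Suc N + A)"
  shows "A * p * q N \<le> (1 + (1 - q N) * A) * (Suc N + A - load * (g * (1 - R ^ B)))"
proof -
  let ?M = "Suc N + A"
  have g: "0 < g" "g \<le> 1"
    unfolding g_def using Z_pos Z_mono[of "?M - B" ?M] by auto
  have Rb: "0 \<le> 1 - R ^ B" "1 - R ^ B \<le> 1"
    using R by (auto intro!: power_le_one)
  have g_le: "g \<le> Z (?M - a) / Z ?M" if "a \<le> B" for a
    unfolding g_def using that Z_pos[of ?M] by (intro divide_right_mono Z_mono) auto
  \<comment> \<open>With \<open>T\<close> for the geometric sum,
    \<open>(1 - q N) * T = q N * (1 - q N ^ A)\<close> and \<open>A * q N ^ Suc A \<le> T\<close>.
    Adding these gives the bound without dividing by \<open>1 - q N\<close>.\<close>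
  have S: "A * q N \<le> (1 + (1 - q N) * A) * (\<Sum>a=1..A. q N ^ a)"
  proof -
    have "(\<Sum>a=1..A. q N ^ Suc A) \<le> (\<Sum>a=1..A. q N ^ a)"
      using q_pos[of N] q_le_1[of N] by (intro sum_mono power_decreasing) auto
    moreover have "A * ((1 - q N) * (\<Sum>a=1..A. q N ^ a)) = A * (q N * (1 - q N ^ A))"
      by (simp only: sum_power_from_1)
    ultimately show ?thesis by (simp add: algebra_simps)
  qed
  \<comment> \<open>The free monomers and all filaments beyond \<open>p\<close> are bounded below
    with one common factor \<open>g * (1 - R ^ B)\<close>, so that their sum is \<open>load\<close>
    times that factor. Here \<open>1 \<le> B\<close> gives \<open>g \<le> q (N + A)\<close>.\<close>
  have "u * (g * (1 - R ^ B)) \<le> u * q (N + A)"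
  proof (intro mult_left_mono)
    have "g * (1 - R ^ B) \<le> g" using g Rb by (simp add: mult_left_le)
    also have "g \<le> q (N + A)" using g_le[of 1] assms by (simp add: q_def)
    finally show "g * (1 - R ^ B) \<le> q (N + A)" .
  qed (use u_pos in simp)
  moreover have "(\<Sum>i\<in>{p<..n}. r i / (1 - r i)) * (g * (1 - R ^ B))
      \<le> (\<Sum>i\<in>{p<..n}. \<Sum>a=1..?M. r i ^ a * (Z (?M - a) / Z ?M))"
    unfolding sum_distrib_right
  proof (rule sum_mono)
    fix i assume i: "i \<in> {p<..n}"
    have ri: "0 < r i" "r i < 1" "r i \<le> R" using r_other[OF i] r_lt_1[OF i] by auto
    \<comment> \<open>Only the terms \<open>a \<le> B\<close> are kept: on them the ratio of
      \<open>Z\<close> is at least \<open>g\<close>, and the discarded geometric tail has relative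
      size \<open>r i ^ B \<le> R ^ B\<close>.\<close>
    have "r i / (1 - r i) * (g * (1 - R ^ B)) \<le> r i / (1 - r i) * (g * (1 - r i ^ B))"
      using ri g by (intro mult_left_mono diff_left_mono power_mono) auto
    also have "\<dots> = (\<Sum>a=1..B. r i ^ a * g)"
      proof -
        have "r i / (1 - r i) * (1 - r i ^ B) = (\<Sum>a=1..B. r i ^ a)"
          unfolding times_divide_eq_left sum_power_from_1[symmetric] using ri(2) by simp
        then show ?thesis by (simp only: sum_distrib_left[symmetric] mult.left_commute mult.commute)
      qed
    also have "\<dots> \<le> (\<Sum>a=1..B. r i ^ a * (Z (?M - a) / Z ?M))"
      using ri g_le by (intro sum_mono mult_left_mono) auto
    also have "\<dots> \<le> (\<Sum>a=1..?M. r i ^ a * (Z (?M - a) / Z ?M))"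
      using ri Z_pos assms by (intro sum_mono2) (auto simp: less_imp_le)
    finally show "r i / (1 - r i) * (g * (1 - R ^ B)) \<le> (\<Sum>a=1..?M. r i ^ a * (Z (?M - a) / Z ?M))" .
  qed
  moreover have "real p * (\<Sum>a=1..A. q N ^ a) \<le> real p * (\<Sum>a=1..?M. Z (?M - a) / Z ?M)"
  proof (intro mult_left_mono)
    have "(\<Sum>a=1..A. q N ^ a) \<le> (\<Sum>a=1..A. Z (?M - a) / Z ?M)"
    proof (rule sum_mono)
      fix a assume a: "a \<in> {1..A}"
      have "q N ^ a \<le> q (?M - a) ^ a"
        using a q_pos[of N] by (intro power_mono q_mono) auto
      also have "\<dots> \<le> Z (?M - a) / Z ?M"
        using a Z_diff_ge[of "?M - a" a] Z_pos[of ?M] by (simp add: le_divide_eq)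
      finally show "q N ^ a \<le> Z (?M - a) / Z ?M" .
    qed
    also have "\<dots> \<le> (\<Sum>a=1..?M. Z (?M - a) / Z ?M)"
      using Z_pos by (intro sum_mono2) (auto simp: less_imp_le)
    finally show "(\<Sum>a=1..A. q N ^ a) \<le> (\<Sum>a=1..?M. Z (?M - a) / Z ?M)" .
  qed simp
  ultimately have "p * (\<Sum>a=1..A. q N ^ a) \<le> Suc N + A - load * (g * (1 - R ^ B))"
    using mass_balance[of "N + A"] unfolding load_def distrib_right add_Suc by linarith
  then have bound: "(1 + (1 - q N) * A) * (p * (\<Sum>a=1..A. q N ^ a)) \<le>
      (1 + (1 - q N) * A) * (Suc N + A - load * (g * (1 - R ^ B)))"
    using q_le_1[of N] by (intro mult_left_mono) auto
  have "A * p * q N = p * (A * q N)" by simp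
  also have "\<dots> \<le> p * ((1 + (1 - q N) * A) * (\<Sum>a=1..A. q N ^ a))"
    using S by (intro mult_left_mono) auto
  also have "\<dots> = (1 + (1 - q N) * A) * (p * (\<Sum>a=1..A. q N ^ a))"
    by (rule mult.left_commute)
  also note bound
  finally show ?thesis .
qed

end

section \<open>Asymptotics of ratios\<close>

locale filament_sequence =
  fixes u :: "nat \<Rightarrow> real" and r :: "nat \<Rightarrow> nat \<Rightarrow> real" and n p :: "nat \<Rightarrow> nat" and R c :: real
  assumes system: "\<And>m. 1 \<le> m \<Longrightarrow> filament_system (u m) (r m) (n m) (p m) R"
    and load_lim: "(\<lambda>m. filament_system.load (u m) (r m) (n m) (p m) / m) \<longlonglongrightarrow> c" and c: "c < 1"
    and p_at_top: "filterlim p at_top sequentially"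
    and p_small: "(\<lambda>m. p m / m) \<longlonglongrightarrow> 0"
begin

abbreviation load :: "nat \<Rightarrow> real" where
  "load m \<equiv> filament_system.load (u m) (r m) (n m) (p m)"

abbreviation Z :: "nat \<Rightarrow> nat \<Rightarrow> real" where
  "Z m \<equiv> reduced_sum (u m) (r m) (n m)"

lemma p_pos: "1 \<le> m \<Longrightarrow> 0 < p m"
  using filament_system.p(1)[OF system] by fastforce

lemma inverse_sqrt_p_tendsto: "(\<lambda>m. 1 / sqrt (p m)) \<longlonglongrightarrow> 0"
  by (intro tendsto_divide_0[OF tendsto_const] filterlim_at_top_imp_at_infinity
      filterlim_compose[OF sqrt_at_top] filterlim_compose[OF filterlim_real_sequentially] p_at_top)

lemma inverse_p_tendsto: "(\<lambda>m. 1 / p m) \<longlonglongrightarrow> 0"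
  by (intro tendsto_divide_0[OF tendsto_const] filterlim_at_top_imp_at_infinity
      filterlim_compose[OF filterlim_real_sequentially] p_at_top)

lemma tendsto_0_if_scaled:
  fixes a :: "nat \<Rightarrow> nat"
  assumes "(\<lambda>m. a m * p m / m) \<longlonglongrightarrow> y"
  shows "(\<lambda>m. a m / m) \<longlonglongrightarrow> 0"
proof (rule Lim_transform_eventually)
  show "(\<lambda>m. a m * p m / m * (1 / p m)) \<longlonglongrightarrow> 0"
    using tendsto_mult[OF assms inverse_p_tendsto] by simp
  show "\<forall>\<^sub>F m in sequentially. a m * p m / m * (1 / p m) = a m / m"
    using eventually_ge_at_top[of 1] by eventually_elim (use p_pos in fastforce)
qed

text \<open>As \<open>a m / m\<close> tends to 0, the denominator divided by \<open>m\<close> tends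
  to \<open>1 - c > 0\<close>, so \<open>Z_ratio_ge_exp\<close> eventually applies. The index
  \<open>N m\<close> is kept separate from \<open>m\<close> because the estimate is also needed at
  \<open>m + A m\<close>.\<close>

lemma
  fixes a N :: "nat \<Rightarrow> nat"
  assumes a: "(\<lambda>m. a m * p m / m) \<longlonglongrightarrow> y" and N: "(\<lambda>m. N m / m) \<longlonglongrightarrow> 1"
  shows eventually_Z_ratio_ge:
      "\<forall>\<^sub>F m in sequentially. a m \<le> N m \<and>
         exp (- (a m * p m / (N m - real (a m) - load m))) \<le> Z m (N m - a m) / Z m (N m)"
    and Z_ratio_lower_bound_tendsto:
      "(\<lambda>m. exp (- (a m * p m / (N m - real (a m) - load m)))) \<longlonglongrightarrow> exp (- (y / (1 - c)))"
proof -
  have "(\<lambda>m. N m / m - a m / m - load m / m) \<longlonglongrightarrow> 1 - 0 - c"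
    by (intro tendsto_diff N tendsto_0_if_scaled[OF a] load_lim)
  then have D: "(\<lambda>m. (N m - real (a m) - load m) / m) \<longlonglongrightarrow> 1 - c"
    by (simp add: diff_divide_distrib)
  have "0 < 1 - c" using c by simp
  have D_pos: "\<forall>\<^sub>F m in sequentially. 1 \<le> m \<and> 0 < N m - real (a m) - load m"
    using order_tendstoD(1)[OF D \<open>0 < 1 - c\<close>] eventually_ge_at_top[of 1]
    by eventually_elim (auto simp: zero_less_divide_iff)
  then show "\<forall>\<^sub>F m in sequentially. a m \<le> N m \<and>
         exp (- (a m * p m / (N m - real (a m) - load m))) \<le> Z m (N m - a m) / Z m (N m)"
  proof eventually_elim
    case (elim m)
    then have "a m \<le> N m" using filament_system.load_pos[OF system, of m] by linarith
    then show ?case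
      using filament_system.Z_ratio_ge_exp[OF system, of m "a m" "N m"] elim by auto
  qed
  show "(\<lambda>m. exp (- (a m * p m / (N m - real (a m) - load m)))) \<longlonglongrightarrow> exp (- (y / (1 - c)))"
  proof (intro tendsto_exp tendsto_minus)
    show "(\<lambda>m. a m * p m / (N m - real (a m) - load m)) \<longlonglongrightarrow> y / (1 - c)"
    proof (rule Lim_transform_eventually)
      show "(\<lambda>m. a m * p m / m / ((N m - real (a m) - load m) / m)) \<longlonglongrightarrow> y / (1 - c)"
        using c by (intro tendsto_divide a D) auto
      show "\<forall>\<^sub>F m in sequentially. a m * p m / m / ((N m - real (a m) - load m) / m)
          = a m * p m / (N m - real (a m) - load m)"
        using eventually_ge_at_top[of 1] by eventually_elim auto
    qed
  qed
qed

text \<open>For shifts of smaller order than \<open>m / p m\<close> the lower bound suffices, since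
  the ratio is at most 1. The result is thus available for proving the upper bound for larger
  shifts.\<close>

lemma Z_ratio_tendsto_1:
  fixes a N :: "nat \<Rightarrow> nat"
  assumes a: "(\<lambda>m. a m * p m / m) \<longlonglongrightarrow> 0" and N: "(\<lambda>m. N m / m) \<longlonglongrightarrow> 1"
  shows "(\<lambda>m. Z m (N m - a m) / Z m (N m)) \<longlonglongrightarrow> 1"
proof (rule tendsto_sandwich)
  show "\<forall>\<^sub>F m in sequentially.
      exp (- (a m * p m / (N m - real (a m) - load m))) \<le> Z m (N m - a m) / Z m (N m)"
    using eventually_Z_ratio_ge[OF a N] by eventually_elim simp
  show "\<forall>\<^sub>F m in sequentially. Z m (N m - a m) / Z m (N m) \<le> 1"
    using eventually_ge_at_top[of 1]
    by eventually_elim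
       (simp add: filament_system.Z_mono[OF system] divide_le_eq_1 filament_system.Z_pos[OF system])
  show "(\<lambda>m. exp (- (a m * p m / (N m - real (a m) - load m)))) \<longlonglongrightarrow> 1"
    using Z_ratio_lower_bound_tendsto[OF a N] by simp
qed simp

lemma index_ratio: "(\<lambda>m. real m / real m) \<longlonglongrightarrow> 1"
  by (rule Lim_transform_eventually[OF tendsto_const])
     (use eventually_ge_at_top[of 1] in eventually_elim, auto)

lemma Z_ratio_fixed_shift_tendsto: "(\<lambda>m. Z m (m - a) / Z m m) \<longlonglongrightarrow> 1"
  by (rule Z_ratio_tendsto_1[where a = "\<lambda>_. a" and N = "\<lambda>m. m"])
     (use tendsto_mult_left[OF p_small, of "real a"] index_ratio in simp_all)

text \<open>This is the converse of \<open>q_deficit_le\<close> to leading order: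
  \<open>1 - q (m - 1)\<close> is at least about \<open>p m / ((1 - c) * m)\<close>.\<close>

lemma q_deficit_lower_bound:
  obtains w where "w \<longlonglongrightarrow> 1 / (1 - c)"
    and "\<forall>\<^sub>F m in sequentially. w m \<le> (1 - Z m (m - 1) / Z m m) * m / p m"
proof -
  txt \<open>Here \<open>m / p \<lless> A \<lless> m\<close> and \<open>1 \<lless> B \<lless> m / p\<close>.\<close>
  define A where "A m = nat \<lceil>m / sqrt (p m)\<rceil>" for m
  define B where "B m = nat \<lceil>sqrt (m / p m)\<rceil>" for m
  define g where "g m = Z m (m + A m - B m) / Z m (m + A m)" for m
  define D where "D m = m + real (A m) - load m * (g m * (1 - R ^ B m))" for m
  \<comment> \<open>\<open>w\<close> is what remains when \<open>q_deficit_ge\<close> at index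
    \<open>m - 1\<close> is divided by \<open>D m\<close> and multiplied by
    \<open>m / (A m * p m)\<close>. The upper size limit on \<open>A\<close> gives
    \<open>D m / m\<close> the limit \<open>1 - c\<close>, the lower one removes
    \<open>m / (A m * p m)\<close>; the limits on \<open>B\<close> give \<open>g\<close> the limit 1
    and \<open>R ^ B m\<close> the limit 0.\<close>
  define w where "w m = Z m (m - 1) / Z m m * (m / D m) - m / (A m * p m)" for m
  have A_le: "A m \<le> m / sqrt (p m) + 1" for m
  proof -
    have "0 \<le> m / sqrt (p m)" by simp
    then show ?thesis unfolding A_def by linarith
  qed
  have A_ge: "m / sqrt (p m) \<le> A m" for m
    unfolding A_def by linarith
  have B_le: "B m \<le> sqrt (m / p m) + 1" for m
  proof -
    have "0 \<le> sqrt (m / p m)" by simp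
    then show ?thesis unfolding B_def by linarith
  qed
  have B_ge: "sqrt (m / p m) \<le> B m" for m
    unfolding B_def by linarith
  have inv: "(\<lambda>m. 1 / real m) \<longlonglongrightarrow> 0" by (rule lim_1_over_n)
  have A_lim: "(\<lambda>m. A m / m) \<longlonglongrightarrow> 0"
  proof (rule tendsto_sandwich[where f = "\<lambda>_. 0"])
    show "\<forall>\<^sub>F m in sequentially. A m / m \<le> 1 / sqrt (p m) + 1 / m"
      using eventually_ge_at_top[of 1]
    proof eventually_elim
      case (elim m)
      then show ?case using divide_right_mono[OF A_le[of m], of m] by (simp add: add_divide_distrib)
    qed
    show "(\<lambda>m. 1 / sqrt (p m) + 1 / m) \<longlonglongrightarrow> 0"
      using tendsto_add[OF inverse_sqrt_p_tendsto inv] by simp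
  qed auto
  have A_inv: "(\<lambda>m. m / (A m * p m)) \<longlonglongrightarrow> 0"
  proof (rule tendsto_sandwich[where f = "\<lambda>_. 0"])
    show "\<forall>\<^sub>F m in sequentially. m / (A m * p m) \<le> 1 / sqrt (p m)"
      using eventually_ge_at_top[of 1]
    proof eventually_elim
      case (elim m)
      then have "0 < p m" by (rule p_pos)
      then have "0 < m / sqrt (p m)" using elim by simp
      then have "0 < A m" using A_ge[of m] by linarith
      have "m * sqrt (p m) = m / sqrt (p m) * p m"
        using \<open>0 < p m\<close> by (simp add: field_simps flip: power2_eq_square)
      also have "\<dots> \<le> real (A m) * p m" using A_ge[of m] by (intro mult_right_mono) auto
      finally show ?case using \<open>0 < p m\<close> \<open>0 < A m\<close> by (simp add: divide_simps)
    qed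
    show "(\<lambda>m. 1 / sqrt (p m)) \<longlonglongrightarrow> 0" by (rule inverse_sqrt_p_tendsto)
  qed auto
  have B_lim: "(\<lambda>m. B m * p m / m) \<longlonglongrightarrow> 0"
  proof (rule tendsto_sandwich[where f = "\<lambda>_. 0"])
    show "\<forall>\<^sub>F m in sequentially. B m * p m / m \<le> sqrt (p m / m) + p m / m"
      using eventually_ge_at_top[of 1]
    proof eventually_elim
      case (elim m)
      then have "0 < p m" by (rule p_pos)
      have "B m * (p m / m) \<le> (sqrt (m / p m) + 1) * (p m / m)"
        using B_le[of m] by (intro mult_right_mono) auto
      also have "\<dots> = sqrt (m / p m) * (sqrt (p m / m))\<^sup>2 + p m / m"
        by (simp add: distrib_right add_divide_distrib)
      also have "\<dots> = (sqrt (m / p m) * sqrt (p m / m)) * sqrt (p m / m) + p m / m"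
        by (simp only: power2_eq_square mult.assoc)
      also have "sqrt (m / p m) * sqrt (p m / m) = 1"
        using \<open>0 < p m\<close> elim by (simp flip: real_sqrt_mult)
      finally show ?case by simp
    qed
    show "(\<lambda>m. sqrt (p m / m) + p m / m) \<longlonglongrightarrow> 0"
      using tendsto_add[OF tendsto_real_sqrt[OF p_small] p_small] by simp
  qed auto
  have "filterlim (\<lambda>m. sqrt (m / p m)) at_top sequentially"
  proof (rule filterlim_compose[OF sqrt_at_top])
    have "filterlim (\<lambda>m. inverse (p m / m)) at_top sequentially"
      using p_small
    proof (rule filterlim_inverse_at_top)
      show "\<forall>\<^sub>F m in sequentially. 0 < p m / real m"
        using eventually_ge_at_top[of 1] by eventually_elim (use p_pos in simp)
    qed
    then show "filterlim (\<lambda>m. m / p m) at_top sequentially" by simp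
  qed
  then have "filterlim (\<lambda>m. real (B m)) at_top sequentially"
    by (rule filterlim_at_top_mono) (simp add: B_ge)
  then have B_top: "filterlim B at_top sequentially"
    by (simp add: filterlim_sequentially_iff_filterlim_real)
  have R_B: "(\<lambda>m. R ^ B m) \<longlonglongrightarrow> 0"
    using filament_system.R[OF system[of 1]]
    by (intro filterlim_compose[OF LIMSEQ_power_zero B_top]) auto
  have shift: "(\<lambda>m. real (m + A m) / m) \<longlonglongrightarrow> 1"
    using tendsto_add[OF index_ratio A_lim] by (simp add: add_divide_distrib)
  have g: "g \<longlonglongrightarrow> 1"
    unfolding g_def by (rule Z_ratio_tendsto_1[OF B_lim shift])
  have "(\<lambda>m. real (m + A m) / m - load m / m * (g m * (1 - R ^ B m))) \<longlonglongrightarrow> 1 - c * (1 * (1 - 0))"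
    by (intro tendsto_intros shift load_lim g R_B)
  then have D: "(\<lambda>m. D m / m) \<longlonglongrightarrow> 1 - c"
    by (simp add: D_def diff_divide_distrib)
  have c': "0 < 1 - c" using c by simp
  have "(\<lambda>m. Z m (m - 1) / Z m m * inverse (D m / m) - m / (A m * p m)) \<longlonglongrightarrow> 1 * inverse (1 - c) - 0"
    using c' by (intro tendsto_intros Z_ratio_fixed_shift_tendsto D A_inv) auto
  then have "w \<longlonglongrightarrow> 1 / (1 - c)"
    unfolding w_def by (simp add: divide_inverse mult_ac)
  moreover have "\<forall>\<^sub>F m in sequentially. w m \<le> (1 - Z m (m - 1) / Z m m) * m / p m"
    \<comment> \<open>\<open>eventually_Z_ratio_ge\<close> supplies
      \<open>B m \<le> m + A m\<close>, a premise of \<open>q_deficit_ge\<close>.\<close>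
    using eventually_ge_at_top[of 1] order_tendstoD(1)[OF D c'] eventually_Z_ratio_ge[OF B_lim shift]
      filterlim_at_top[THEN iffD1, OF B_top, rule_format, of 1]
  proof eventually_elim
    case (elim m)
    let ?q = "Z m (m - 1) / Z m m"
    have m: "Suc (m - 1) = m" "0 < m" using elim by auto
    have "0 < p m" using elim p_pos by simp
    then have "0 < m / sqrt (p m)" using m by simp
    then have "0 < A m" using A_ge[of m] by linarith
    have "0 < D m" using elim m by (auto simp: zero_less_divide_iff)
    have "A m * p m * ?q \<le> (1 + (1 - ?q) * A m) * D m"
      using filament_system.q_deficit_ge[OF system, of m "B m" "m - 1" "A m"] elim
      unfolding filament_system.q_def[OF system[OF elim(1)]] D_def g_def m by simp
    then have "A m * p m * ?q / D m \<le> 1 + (1 - ?q) * A m"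
      using \<open>0 < D m\<close> by (simp only: pos_divide_le_eq)
    then have "A m * p m * ?q / D m * (m / (A m * p m)) \<le> (1 + (1 - ?q) * A m) * (m / (A m * p m))"
      by (intro mult_right_mono) auto
    also have "\<dots> = m / (A m * p m) + (1 - ?q) * m / p m"
      using \<open>0 < A m\<close> by (simp add: distrib_right add_divide_distrib)
    also have "A m * p m * ?q / D m * (m / (A m * p m)) = ?q * (m / D m)"
      using \<open>0 < A m\<close> \<open>0 < p m\<close> by simp
    finally show ?case unfolding w_def by simp
  qed
  ultimately show thesis by (rule that)
qed

text \<open>From above, the ratio is at most \<open>exp (- (a m * (1 - q (m - 1))))\<close>, and
  \<open>w\<close> bounds this exponent by a sequence with the same limit as the lower
  bound.\<close>

theorem Z_ratio_tendsto:
  fixes a :: "nat \<Rightarrow> nat"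
  assumes a: "(\<lambda>m. a m * p m / m) \<longlonglongrightarrow> y"
  shows "(\<lambda>m. Z m (m - a m) / Z m m) \<longlonglongrightarrow> exp (- (y / (1 - c)))"
proof -
  obtain w where w: "w \<longlonglongrightarrow> 1 / (1 - c)"
    and w_le: "\<forall>\<^sub>F m in sequentially. w m \<le> (1 - Z m (m - 1) / Z m m) * m / p m"
    by (rule q_deficit_lower_bound)
  show ?thesis
  proof (rule tendsto_sandwich)
    show "\<forall>\<^sub>F m in sequentially.
        exp (- (a m * p m / (m - real (a m) - load m))) \<le> Z m (m - a m) / Z m m"
      using eventually_Z_ratio_ge[OF a index_ratio] by eventually_elim simp
    show "(\<lambda>m. exp (- (a m * p m / (m - real (a m) - load m)))) \<longlonglongrightarrow> exp (- (y / (1 - c)))"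
      by (rule Z_ratio_lower_bound_tendsto[OF a index_ratio])
    show "\<forall>\<^sub>F m in sequentially. Z m (m - a m) / Z m m \<le> exp (- (a m * p m / m * w m))"
      using w_le eventually_Z_ratio_ge[OF a index_ratio] eventually_ge_at_top[of 1]
    proof eventually_elim
      case (elim m)
      let ?d = "1 - Z m (m - 1) / Z m m"
      have m: "Suc (m - 1) = m" "0 < p m" using elim p_pos by auto
      have "a m * p m / m * w m \<le> a m * p m / m * (?d * m / p m)"
        using elim by (intro mult_left_mono) auto
      also have "\<dots> = a m * ?d" using elim m by simp
      finally have "exp (- (a m * ?d)) \<le> exp (- (a m * p m / m * w m))" by simp
      moreover have "Z m (m - a m) / Z m m \<le> exp (- (a m * ?d))"
        using filament_system.Z_ratio_le_exp[OF system, of m "a m" "m - 1"] elim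
        unfolding filament_system.q_def[OF system[OF elim(3)]] m by simp
      ultimately show ?case by linarith
    qed
    have "(\<lambda>m. exp (- (a m * p m / m * w m))) \<longlonglongrightarrow> exp (- (y * (1 / (1 - c))))"
      by (intro tendsto_intros a w)
    then show "(\<lambda>m. exp (- (a m * p m / m * w m))) \<longlonglongrightarrow> exp (- (y / (1 - c)))" by simp
  qed
qed

end

section \<open>Moments and marginals\<close>

lemma
  assumes "0 < u"
  shows integrable_real_poisson_pmf: "integrable (poisson_pmf u) real"
    and expectation_poisson_pmf: "measure_pmf.expectation (poisson_pmf u) real = u"
proof -
  \<comment> \<open>The mean is summed after a shift: \<open>k + 1\<close> times the mass at
    \<open>k + 1\<close> equals \<open>u\<close> times the mass at \<open>k\<close>.\<close>
  have "(\<lambda>k. u ^ k / fact k * (u * exp (- u))) sums (exp u * (u * exp (- u)))"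
    using exp_converges[of u] by (intro sums_mult2) (simp add: divide_inverse mult.commute)
  also have "exp u * (u * exp (- u)) = u"
    by (simp add: exp_minus)
  also have "(\<lambda>k. u ^ k / fact k * (u * exp (- u))) = (\<lambda>k. pmf (poisson_pmf u) (Suc k) * real (Suc k))"
    using assms by (simp add: fun_eq_iff del: of_nat_Suc)
  finally have s: "(\<lambda>k. pmf (poisson_pmf u) k * real k) sums u"
    by (subst (asm) sums_Suc_iff) simp
  then have i: "integrable (count_space UNIV) (\<lambda>k. pmf (poisson_pmf u) k * real k)"
    unfolding integrable_count_space_nat_iff by (simp add: sums_iff abs_mult)
  then show "integrable (poisson_pmf u) real"
    unfolding measure_pmf_eq_density by (subst integrable_density) auto
  show "measure_pmf.expectation (poisson_pmf u) real = u"
    unfolding measure_pmf_eq_density using i s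
    by (subst integral_density) (auto simp: integral_count_space_nat sums_iff)
qed

lemma
  assumes "0 < k 1" and r: "\<And>i. i \<in> {min_count n k<..n} \<Longrightarrow> 0 < k 1 / k i \<and> k 1 / k i < 1"
  shows expectation_aux_M: "measure_pmf.expectation (aux_pmf n k) aux_M = k 1"
    and expectation_aux_S: "measure_pmf.expectation (aux_pmf n k) (aux_S n k) =
          (\<Sum>i\<in>{min_count n k<..n}. (k 1 / k i) / (1 - k 1 / k i))"
    and expectation_aux_M_S: "measure_pmf.expectation (aux_pmf n k) (\<lambda>\<omega>. aux_M \<omega> + aux_S n k \<omega>) =
          k 1 + (\<Sum>i\<in>{min_count n k<..n}. (k 1 / k i) / (1 - k 1 / k i))"
proof -
  let ?I = "{min_count n k<..n}" and ?G = "\<lambda>i. geometric_tail_pmf (k 1 / k i)"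
  let ?P = "poisson_pmf (k 1)" and ?Q = "Pi_pmf ?I 0 ?G"
  have G: "integrable (?G i) real" "measure_pmf.expectation (?G i) real = (k 1 / k i) / (1 - k 1 / k i)"
    if "i \<in> ?I" for i
    using r[OF that] unfolding geometric_tail_pmf_def
    by (auto simp: integrable_real_geometric_pmf expectation_geometric_pmf)
  have M: "aux_M = (\<lambda>\<omega>. real (fst \<omega>))" by (simp add: fun_eq_iff aux_M_def)
  have S: "aux_S n k = (\<lambda>\<omega>. \<Sum>i\<in>?I. real (snd \<omega> i))" by (simp add: fun_eq_iff aux_S_def aux_L_def)
  have "integrable (map_pmf fst (pair_pmf ?P ?Q)) real"
    unfolding map_fst_pair_pmf by (rule integrable_real_poisson_pmf[OF assms(1)])
  then have iM: "integrable (aux_pmf n k) aux_M"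
    unfolding integrable_map_pmf_eq M aux_pmf_def by simp
  have "integrable (map_pmf snd (pair_pmf ?P ?Q)) (\<lambda>g. \<Sum>i\<in>?I. real (g i))"
    unfolding map_snd_pair_pmf by (intro integrable_sum_Pi_pmf G) auto
  then have iS: "integrable (aux_pmf n k) (aux_S n k)"
    unfolding integrable_map_pmf_eq S aux_pmf_def by simp
  show eM: "measure_pmf.expectation (aux_pmf n k) aux_M = k 1"
    unfolding M aux_pmf_def using expectation_poisson_pmf[OF assms(1)] by simp
  have "measure_pmf.expectation (aux_pmf n k) (aux_S n k) =
      measure_pmf.expectation ?Q (\<lambda>g. \<Sum>i\<in>?I. real (g i))"
    unfolding S aux_pmf_def by (rule expectation_pair_pmf_snd)
  also have "\<dots> = (\<Sum>i\<in>?I. measure_pmf.expectation (?G i) real)"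
    by (intro expectation_sum_Pi_pmf G) auto
  finally show eS: "measure_pmf.expectation (aux_pmf n k) (aux_S n k) =
      (\<Sum>i\<in>?I. (k 1 / k i) / (1 - k 1 / k i))"
    using G(2) by simp
  show "measure_pmf.expectation (aux_pmf n k) (\<lambda>\<omega>. aux_M \<omega> + aux_S n k \<omega>) =
      k 1 + (\<Sum>i\<in>?I. (k 1 / k i) / (1 - k 1 / k i))"
    using Bochner_Integration.integral_add[OF iM iS] eM eS by simp
qed

text \<open>Each of the \<open>m\<close> monomers, bound or free, receives one factor
  \<open>k 1\<close>, so the total correction \<open>k 1 ^ m\<close> does not depend on
  \<open>l\<close>.\<close>

lemma config_weight_eq_reduced_weight:
  assumes "0 < k 1" "l \<in> configs m n"
  shows "config_weight m n k l = fact m / k 1 ^ m * reduced_weight (k 1) (\<lambda>i. k 1 / k i) n m l"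
proof -
  let ?s = "\<Sum>i=1..n. l i"
  let ?P = "\<Prod>i=1..n. inverse (k i) ^ l i"
  have "(\<Prod>i=1..n. (k 1 / k i) ^ l i) = k 1 ^ ?s * ?P"
    by (simp add: divide_inverse power_mult_distrib prod.distrib power_sum)
  then have "(\<Prod>i=1..n. (k 1 / k i) ^ l i) * k 1 ^ (m - ?s) = (k 1 ^ ?s * k 1 ^ (m - ?s)) * ?P"
    by (simp only: mult_ac)
  also have "k 1 ^ ?s * k 1 ^ (m - ?s) = k 1 ^ m"
    using assms(2) by (simp add: configs_def flip: power_add)
  finally have "(\<Prod>i=1..n. (k 1 / k i) ^ l i) * k 1 ^ (m - ?s) = k 1 ^ m * ?P" .
  then show ?thesis
    using assms(1) unfolding config_weight_def reduced_weight_def by simp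
qed

lemma pmf_stationary_reduced:
  assumes "0 < k 1" "\<forall>i\<in>{1..n}. 0 < k i"
  shows "pmf (stationary_pmf m n k) l = (if l \<in> configs m n then
     reduced_weight (k 1) (\<lambda>i. k 1 / k i) n m l / reduced_sum (k 1) (\<lambda>i. k 1 / k i) n m else 0)"
proof -
  have "partition_sum m n k = fact m / k 1 ^ m * reduced_sum (k 1) (\<lambda>i. k 1 / k i) n m"
    unfolding partition_sum_def reduced_sum_def sum_distrib_left
    using assms(1) by (intro sum.cong config_weight_eq_reduced_weight) auto
  moreover have "pmf (stationary_pmf m n k) l =
      (if l \<in> configs m n then config_weight m n k l / partition_sum m n k else 0)"
    using assms(2) by (intro pmf_stationary) auto
  ultimately show ?thesis
    using assms(1) by (simp add: config_weight_eq_reduced_weight)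
qed

lemma set_stationary_pmf_subset:
  assumes "\<forall>i\<in>{1..n}. 0 < k i"
  shows "set_pmf (stationary_pmf m n k) \<subseteq> configs m n"
proof
  fix l assume "l \<in> set_pmf (stationary_pmf m n k)"
  moreover have "pmf (stationary_pmf m n k) l =
      (if l \<in> configs m n then config_weight m n k l / partition_sum m n k else 0)"
    using assms by (intro pmf_stationary) auto
  ultimately show "l \<in> configs m n" by (auto simp: set_pmf_iff split: if_splits)
qed

lemma expectation_stationary:
  assumes "0 < k 1" "\<forall>i\<in>{1..n}. 0 < k i"
  shows "measure_pmf.expectation (stationary_pmf m n k) h =
     (\<Sum>l\<in>configs m n. h l * reduced_weight (k 1) (\<lambda>i. k 1 / k i) n m l)
       / reduced_sum (k 1) (\<lambda>i. k 1 / k i) n m"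
proof -
  have "measure_pmf.expectation (stationary_pmf m n k) h =
      (\<Sum>l\<in>configs m n. h l * pmf (stationary_pmf m n k) l)"
    using set_stationary_pmf_subset[OF assms(2)] by (intro integral_measure_pmf_real finite_configs) auto
  then show ?thesis by (simp add: pmf_stationary_reduced[OF assms] sum_divide_distrib)
qed

lemma prob_stationary_tail:
  assumes "0 < k 1" "\<forall>i\<in>{1..n}. 0 < k i" and i: "i \<in> {1..n}" and "a \<le> m"
  shows "measure_pmf.prob (stationary_pmf m n k) {l. a \<le> l i} = (k 1 / k i) ^ a *
     (reduced_sum (k 1) (\<lambda>i. k 1 / k i) n (m - a) / reduced_sum (k 1) (\<lambda>i. k 1 / k i) n m)"
proof -
  let ?W = "reduced_weight (k 1) (\<lambda>i. k 1 / k i) n m"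
  have "measure_pmf.prob (stationary_pmf m n k) {l. a \<le> l i}
      = measure_pmf.expectation (stationary_pmf m n k) (indicator {l. a \<le> l i})"
    by simp
  also have "\<dots> = (\<Sum>l\<in>configs m n. indicator {l. a \<le> l i} l * ?W l)
      / reduced_sum (k 1) (\<lambda>i. k 1 / k i) n m"
    by (rule expectation_stationary[OF assms(1,2)])
  also have "(\<Sum>l\<in>configs m n. indicator {l. a \<le> l i} l * ?W l) = (\<Sum>l\<in>{l \<in> configs m n. a \<le> l i}. ?W l)"
    unfolding sum.inter_filter[OF finite_configs] by (intro sum.cong) (auto simp: indicator_def)
  finally show ?thesis
    unfolding sum_reduced_weight_tail[OF i \<open>a \<le> m\<close>] by (simp only: times_divide_eq_right)
qed

lemma expectation_free_monomers:
  assumes "0 < k 1" "\<forall>i\<in>{1..n}. 0 < k i"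
  defines "Z \<equiv> reduced_sum (k 1) (\<lambda>i. k 1 / k i) n"
  shows "measure_pmf.expectation (stationary_pmf (Suc N) n k) (free_monomers (Suc N) n) = k 1 * (Z N / Z (Suc N))"
    and "measure_pmf.expectation (stationary_pmf (Suc (Suc N)) n k)
           (\<lambda>l. free_monomers (Suc (Suc N)) n l * (free_monomers (Suc (Suc N)) n l - 1))
         = (k 1)\<^sup>2 * (Z N / Z (Suc (Suc N)))"
proof -
  let ?W = "reduced_weight (k 1) (\<lambda>i. k 1 / k i) n"
  have first: "(\<Sum>l\<in>configs (Suc N) n. free_monomers (Suc N) n l * ?W (Suc N) l) = k 1 * Z N"
    using sum_free_reduced_weight[of N n "\<lambda>_. 1" "k 1" "\<lambda>i. k 1 / k i"] by (simp add: Z_def reduced_sum_def)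
  then show "measure_pmf.expectation (stationary_pmf (Suc N) n k) (free_monomers (Suc N) n) = k 1 * (Z N / Z (Suc N))"
    by (simp add: expectation_stationary[OF assms(1,2)] Z_def)
  \<comment> \<open>The second factor is again a free-monomer count, with one monomer fewer, so
    \<open>sum_free_reduced_weight\<close> applies twice.\<close>
  have "free_monomers (Suc (Suc N)) n l - 1 = free_monomers (Suc N) n l" for l
    by (simp add: free_monomers_def)
  then have "(\<Sum>l\<in>configs (Suc (Suc N)) n. free_monomers (Suc (Suc N)) n l *
      (free_monomers (Suc (Suc N)) n l - 1) * ?W (Suc (Suc N)) l) = k 1 * (k 1 * Z N)"
    using sum_free_reduced_weight[of "Suc N" n "free_monomers (Suc N) n" "k 1" "\<lambda>i. k 1 / k i"] first
    by simp
  then show "measure_pmf.expectation (stationary_pmf (Suc (Suc N)) n k)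
           (\<lambda>l. free_monomers (Suc (Suc N)) n l * (free_monomers (Suc (Suc N)) n l - 1))
         = (k 1)\<^sup>2 * (Z N / Z (Suc (Suc N)))"
    by (simp add: expectation_stationary[OF assms(1,2)] Z_def power2_eq_square)
qed

section \<open>Filaments with the smallest dissociation constant\<close>

lemma min_count_le: "min_count n k \<le> n"
proof -
  have "min_count n k \<le> card {1..n}" unfolding filament_count_def by (rule card_mono) auto
  then show ?thesis by simp
qed

text \<open>By monotonicity the minimal filaments form an initial segment \<open>{1..M}\<close>,
  whose cardinality is also its last index. This links the count \<open>min_count\<close> with its
  use as an index bound.\<close>

lemma le_min_count_iff:
  fixes k :: "nat \<Rightarrow> real"
  assumes mono: "mono_on {1..n} k" and i: "i \<in> {1..n}"
  shows "i \<le> min_count n k \<longleftrightarrow> k i = k 1"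
proof -
  define S where "S = {j \<in> {1..n}. k j = k 1}"
  have fin: "finite S" and "1 \<in> S" using i by (auto simp: S_def)
  define M where "M = Max S"
  have "M \<in> S"
    unfolding M_def using Max_in[OF fin] \<open>1 \<in> S\<close> by blast
  then have M: "M \<in> {1..n}" "k M = k 1" by (auto simp: S_def)
  have S: "S = {1..M}"
  proof
    show "S \<subseteq> {1..M}" using fin by (auto simp: S_def M_def)
    show "{1..M} \<subseteq> S"
    proof
      fix j assume j: "j \<in> {1..M}"
      have "k 1 \<le> k j"
        by (rule mono_onD[OF mono]) (use j M(1) in auto)
      moreover have "k j \<le> k M"
        by (rule mono_onD[OF mono]) (use j M(1) in auto)
      ultimately have "k j = k 1" using M(2) by linarith
      then show "j \<in> S" using j M(1) unfolding S_def by auto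
    qed
  qed
  have "min_count n k = card S" by (simp add: filament_count_def S_def)
  also have "\<dots> = M" by (simp add: S)
  finally have "i \<le> min_count n k \<longleftrightarrow> i \<in> S" using i by (simp add: S)
  then show ?thesis using i by (simp add: S_def)
qed

section \<open>Limit laws\<close>

theorem theorem3:
  fixes K :: nat
    and f :: "nat \<Rightarrow> nat"
    and \<kappa> :: "nat \<Rightarrow> nat \<Rightarrow> real"
    and \<kappa>c :: "nat \<Rightarrow> nat \<Rightarrow> real"
    and \<rho>c :: "nat \<Rightarrow> real"
    and \<kappa>bar sbar :: real
  assumes f_pos: "\<And>m. m \<ge> 1 \<Longrightarrow> f m \<ge> 1"
    and \<kappa>_pos: "\<And>m i. m \<ge> 1 \<Longrightarrow> i \<in> {1..f m} \<Longrightarrow> 0 < \<kappa> m i"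
    and \<kappa>_mono: "\<And>m. m \<ge> 1 \<Longrightarrow> mono_on {1..f m} (\<kappa> m)"
    and classes: "\<And>m i. m \<ge> 1 \<Longrightarrow> i \<in> {1..f m} \<Longrightarrow> \<kappa> m i \<in> \<kappa>c m ` {1..K}"
    and classes_mono: "\<And>m. m \<ge> 1 \<Longrightarrow> strict_mono_on {1..K} (\<kappa>c m)"
    and classes_nonempty:
      "\<And>m j. m \<ge> 1 \<Longrightarrow> j \<in> {1..K} \<Longrightarrow> filament_count (f m) (\<kappa> m) (\<kappa>c m j) \<ge> 1"
    and ratios: "\<And>m j. m \<ge> 1 \<Longrightarrow> j \<in> {1..K} \<Longrightarrow> \<kappa>c m 1 / \<kappa>c m j = \<rho>c j"
    and \<kappa>bar: "(\<lambda>m. measure_pmf.expectation (aux_pmf (f m) (\<kappa> m)) aux_M / real m)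
                  \<longlonglongrightarrow> \<kappa>bar" "\<kappa>bar \<ge> 0"
    and sbar: "(\<lambda>m. measure_pmf.expectation (aux_pmf (f m) (\<kappa> m)) (aux_S (f m) (\<kappa> m)) / real m)
                  \<longlonglongrightarrow> sbar" "sbar \<ge> 0"
    and subcritical: "\<kappa>bar + sbar < 1"
    and f1_at_top: "filterlim (\<lambda>m. min_count (f m) (\<kappa> m)) at_top sequentially"
    and f1_small: "(\<lambda>m. real (min_count (f m) (\<kappa> m)) / real m) \<longlonglongrightarrow> 0"
  shows "(\<forall>i x. (\<forall>m\<ge>1. i m \<in> {1..min_count (f m) (\<kappa> m)}) \<longrightarrow> 0 \<le> x \<longrightarrow>
            (\<lambda>m. measure_pmf.prob (stationary_pmf m (f m) (\<kappa> m))
                   {l. real (min_count (f m) (\<kappa> m)) /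
                         (real m - measure_pmf.expectation (aux_pmf (f m) (\<kappa> m))
                                     (\<lambda>\<omega>. aux_M \<omega> + aux_S (f m) (\<kappa> m) \<omega>))
                         * real (l (i m)) \<ge> x})
              \<longlonglongrightarrow> exp (- x)) \<and>
         (\<forall>j\<in>{2..K}. \<forall>i. (\<forall>m\<ge>1. i m \<in> {min_count (f m) (\<kappa> m)<..f m} \<and> \<kappa> m (i m) = \<kappa>c m j) \<longrightarrow>
            (\<forall>n. (\<lambda>m. measure_pmf.prob (stationary_pmf m (f m) (\<kappa> m)) {l. l (i m) = n})
              \<longlonglongrightarrow> pmf (geometric_tail_pmf (\<rho>c j)) n)) \<and>
         (\<forall>\<epsilon>>0. (\<lambda>m. measure_pmf.prob (stationary_pmf m (f m) (\<kappa> m))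
                   {l. \<bar>free_monomers m (f m) l / real m - \<kappa>bar\<bar> > \<epsilon>})
              \<longlonglongrightarrow> 0)"
proof -

  \<comment> \<open>Reduction of the class model to a filament sequence\<close>
  define p where "p m = min_count (f m) (\<kappa> m)" for m
  define u where "u m = \<kappa> m 1" for m
  define r where "r m i = \<kappa> m 1 / \<kappa> m i" for m i
  \<comment> \<open>The ratio of class 2 is the largest one below 1. With a single class there is no
    filament beyond \<open>p m\<close>, and any value in the open unit interval serves.\<close>
  define R where "R = (if 2 \<le> K then \<rho>c 2 else 1 / 2)"
  have u_pos: "0 < u m" if "1 \<le> m" for m
    using \<kappa>_pos[OF that, of 1] f_pos[OF that] by (simp add: u_def)
  have pos: "\<forall>i\<in>{1..f m}. 0 < \<kappa> m i" if "1 \<le> m" for m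
    using \<kappa>_pos[OF that] by blast
  have p_iff: "i \<le> p m \<longleftrightarrow> \<kappa> m i = \<kappa> m 1" if "1 \<le> m" "i \<in> {1..f m}" for m i
    unfolding p_def by (rule le_min_count_iff[OF \<kappa>_mono[OF that(1)] that(2)])
  have class_attained: "\<exists>i\<in>{1..f m}. \<kappa> m i = \<kappa>c m j" if "1 \<le> m" "j \<in> {1..K}" for m j
  proof (rule ccontr)
    assume "\<not> ?thesis"
    then have "{i \<in> {1..f m}. \<kappa> m i = \<kappa>c m j} = {}" by blast
    then have "filament_count (f m) (\<kappa> m) (\<kappa>c m j) = 0"
      unfolding filament_count_def by (simp only: card.empty)
    then show False using classes_nonempty[OF that] by simp
  qed
  have \<kappa>c_pos: "0 < \<kappa>c m j" if "1 \<le> m" "j \<in> {1..K}" for m j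
    using class_attained[OF that] \<kappa>_pos[OF that(1)] by force
  have K: "1 \<le> K"
    using classes[of 1 1] f_pos[of 1] by auto
  have \<kappa>1: "\<kappa> m 1 = \<kappa>c m 1" if m: "1 \<le> m" for m
  proof (rule antisym)
    obtain i where "i \<in> {1..f m}" "\<kappa> m i = \<kappa>c m 1"
      using class_attained[OF m, of 1] K by auto
    then show "\<kappa> m 1 \<le> \<kappa>c m 1"
      using mono_onD[OF \<kappa>_mono[OF m], of 1 i] f_pos[OF m] by simp
    obtain j where "j \<in> {1..K}" "\<kappa> m 1 = \<kappa>c m j"
      using classes[OF m, of 1] f_pos[OF m] by auto
    then show "\<kappa>c m 1 \<le> \<kappa> m 1"
      using strict_mono_onD[OF classes_mono[OF m], of 1 j] by (cases "j = 1") auto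
  qed
  have \<kappa>c_less: "\<kappa>c m i < \<kappa>c m j" if "1 \<le> m" "1 \<le> i" "i < j" "j \<le> K" for m i j
    using strict_mono_onD[OF classes_mono[OF that(1)], of i j] that by simp
  have \<rho>: "0 < \<rho>c j \<and> \<rho>c j \<le> R \<and> \<rho>c j < 1" if "j \<in> {2..K}" for j
  proof -
    \<comment> \<open>The ratios are the same for all \<open>m \<ge> 1\<close>, so their properties
      can be read off at \<open>m = 1\<close>.\<close>
    have c: "0 < \<kappa>c 1 1" "0 < \<kappa>c 1 2" "0 < \<kappa>c 1 j" "\<kappa>c 1 1 < \<kappa>c 1 j" "\<kappa>c 1 2 \<le> \<kappa>c 1 j"
      using \<kappa>c_pos[of 1] \<kappa>c_less[of 1 1 j] \<kappa>c_less[of 1 2 j] that by (auto simp: le_less)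
    have "\<kappa>c 1 1 / \<kappa>c 1 j \<le> \<kappa>c 1 1 / \<kappa>c 1 2"
      using c by (intro divide_left_mono) auto
    then show ?thesis
      using ratios[of 1 j] ratios[of 1 2] c that by (auto simp: R_def simp flip: ratios[of 1 j])
  qed
  have R: "0 < R" "R < 1"
    using \<rho>[of 2] by (auto simp: R_def)
  have r_min: "r m i = 1" if "1 \<le> m" "i \<in> {1..f m}" "i \<le> p m" for m i
    using p_iff[OF that(1,2)] that \<kappa>_pos[OF that(1,2)] by (simp add: r_def)
  have r_other: "0 < r m i \<and> r m i \<le> R \<and> r m i < 1" if m: "1 \<le> m" and i: "i \<in> {p m<..f m}" for m i
  proof -
    have i': "i \<in> {1..f m}" using i by auto
    obtain j where j: "j \<in> {1..K}" "\<kappa> m i = \<kappa>c m j" using classes[OF m i'] by auto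
    have "j \<noteq> 1" using p_iff[OF m i'] i j(2) \<kappa>1[OF m] by auto
    then have "j \<in> {2..K}" using j(1) by auto
    then show ?thesis using \<rho>[of j] ratios[OF m j(1)] j(2) \<kappa>1[OF m] by (simp add: r_def)
  qed
  have system: "filament_system (u m) (r m) (f m) (p m) R" if m: "1 \<le> m" for m
  proof
    show "1 \<le> p m" using p_iff[OF m, of 1] f_pos[OF m] by simp
    show "p m \<le> f m" unfolding p_def by (rule min_count_le)
    then show "r m i = 1" if "i \<in> {1..p m}" for i
      using r_min[OF m, of i] that by auto
    show "0 < r m i \<and> r m i \<le> R" if "i \<in> {p m<..f m}" for i
      using r_other[OF m that] by simp
  qed (use u_pos[OF m] R in auto)
  have aux: "0 < \<kappa> m 1" "\<And>i. i \<in> {min_count (f m) (\<kappa> m)<..f m} \<Longrightarrow> 0 < \<kappa> m 1 / \<kappa> m i \<and> \<kappa> m 1 / \<kappa> m i < 1"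
    if m: "1 \<le> m" for m
    using u_pos[OF m] r_other[OF m] by (auto simp: u_def r_def p_def)
  have mean_M: "measure_pmf.expectation (aux_pmf (f m) (\<kappa> m)) aux_M = u m"
    and mean_S: "measure_pmf.expectation (aux_pmf (f m) (\<kappa> m)) (aux_S (f m) (\<kappa> m))
      = (\<Sum>i\<in>{p m<..f m}. r m i / (1 - r m i))"
    and mean_M_S: "measure_pmf.expectation (aux_pmf (f m) (\<kappa> m)) (\<lambda>\<omega>. aux_M \<omega> + aux_S (f m) (\<kappa> m) \<omega>)
      = filament_system.load (u m) (r m) (f m) (p m)" if m: "1 \<le> m" for m
    unfolding filament_system.load_def[OF system[OF m]] unfolding u_def r_def p_def
    using aux[OF m] by (intro expectation_aux_M expectation_aux_S expectation_aux_M_S; blast)+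
  have u_lim: "(\<lambda>m. u m / m) \<longlonglongrightarrow> \<kappa>bar"
    by (rule Lim_transform_eventually[OF \<kappa>bar(1)], use eventually_ge_at_top[of 1] in eventually_elim)
       (simp only: mean_M)
  have load_lim: "(\<lambda>m. filament_system.load (u m) (r m) (f m) (p m) / m) \<longlonglongrightarrow> \<kappa>bar + sbar"
    by (rule Lim_transform_eventually[OF tendsto_add[OF \<kappa>bar(1) sbar(1)]],
        use eventually_ge_at_top[of 1] in eventually_elim)
       (simp only: mean_M mean_S filament_system.load_def[OF system] add_divide_distrib)
  interpret filament_sequence u r f p R "\<kappa>bar + sbar"
    by (rule filament_sequence.intro[OF system load_lim subcritical
          f1_at_top[folded p_def] f1_small[folded p_def]])
  have r_fun: "r m = (\<lambda>i. \<kappa> m 1 / \<kappa> m i)" for m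
    by (simp add: fun_eq_iff r_def)
  have tail: "measure_pmf.prob (stationary_pmf m (f m) (\<kappa> m)) {l. a \<le> l i} = r m i ^ a * (Z m (m - a) / Z m m)"
    if "1 \<le> m" "i \<in> {1..f m}" "a \<le> m" for m i a
    using prob_stationary_tail[of "\<kappa> m" "f m" i a m] aux(1)[OF that(1)] pos[OF that(1)] that
    by (simp only: u_def r_fun)

  \<comment> \<open>Exponential limit for class 1\<close>
  have "(\<lambda>m. measure_pmf.prob (stationary_pmf m (f m) (\<kappa> m))
                   {l. real (min_count (f m) (\<kappa> m)) /
                         (real m - measure_pmf.expectation (aux_pmf (f m) (\<kappa> m))
                                     (\<lambda>\<omega>. aux_M \<omega> + aux_S (f m) (\<kappa> m) \<omega>))
                         * real (l (i m)) \<ge> x}) \<longlonglongrightarrow> exp (- x)"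
    if i: "\<forall>m\<ge>1. i m \<in> {1..min_count (f m) (\<kappa> m)}" and x: "0 \<le> x" for i x
  proof -
    \<comment> \<open>Once \<open>m - load m\<close> is positive, \<open>a m\<close> is the least
      length in the event, which becomes \<open>a m \<le> l (i m)\<close>. Its probability is a pure
      ratio of \<open>Z\<close>, as \<open>r m (i m) = 1\<close>.\<close>
    define a where "a m = nat \<lceil>x * (m - load m) / p m\<rceil>" for m
    have D_lim: "(\<lambda>m. (m - load m) / m) \<longlonglongrightarrow> 1 - (\<kappa>bar + sbar)"
      using tendsto_diff[OF index_ratio load_lim] by (simp add: diff_divide_distrib)
    have "0 < 1 - (\<kappa>bar + sbar)" using subcritical by simp
    note D_pos = order_tendstoD(1)[OF D_lim this]
    have a_lim: "(\<lambda>m. a m * p m / m) \<longlonglongrightarrow> x * (1 - (\<kappa>bar + sbar))"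
    proof (rule tendsto_sandwich)
      show "\<forall>\<^sub>F m in sequentially. x * ((m - load m) / m) \<le> a m * p m / m"
        using eventually_ge_at_top[of 1]
      proof eventually_elim
        case (elim m)
        have "x * (m - load m) / p m \<le> a m" unfolding a_def by linarith
        then have "x * (m - load m) \<le> a m * p m"
          using p_pos[OF elim] by (simp add: divide_le_eq)
        then show ?case using elim by (simp add: divide_right_mono)
      qed
      show "(\<lambda>m. x * ((m - load m) / m)) \<longlonglongrightarrow> x * (1 - (\<kappa>bar + sbar))"
        by (intro tendsto_intros D_lim)
      show "\<forall>\<^sub>F m in sequentially. a m * p m / m \<le> x * ((m - load m) / m) + p m / m"
        using eventually_ge_at_top[of 1] D_pos
      proof eventually_elim
        case (elim m)
        then have "0 < m - load m" by (auto simp: zero_less_divide_iff)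
        then have "0 \<le> x * (m - load m) / p m" using x by simp
        then have "a m \<le> x * (m - load m) / p m + 1" unfolding a_def by linarith
        then have "real (a m) * p m \<le> (x * (m - load m) / p m + 1) * p m"
          by (intro mult_right_mono) auto
        also have "\<dots> = x * (m - load m) + p m"
          using p_pos[OF elim(1)] by (simp add: distrib_right)
        finally have "real (a m) * p m / m \<le> (x * (m - load m) + p m) / m"
          by (intro divide_right_mono) auto
        then show ?case by (simp add: add_divide_distrib)
      qed
      show "(\<lambda>m. x * ((m - load m) / m) + p m / m) \<longlonglongrightarrow> x * (1 - (\<kappa>bar + sbar))"
        using tendsto_add[OF tendsto_mult_left[OF D_lim, of x] p_small] by simp
    qed
    have "(\<lambda>m. Z m (m - a m) / Z m m) \<longlonglongrightarrow> exp (- x)"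
      using Z_ratio_tendsto[OF a_lim] subcritical by simp
    then show ?thesis
    proof (rule Lim_transform_eventually)
      show "\<forall>\<^sub>F m in sequentially. Z m (m - a m) / Z m m = measure_pmf.prob (stationary_pmf m (f m) (\<kappa> m))
                   {l. real (min_count (f m) (\<kappa> m)) /
                         (real m - measure_pmf.expectation (aux_pmf (f m) (\<kappa> m))
                                     (\<lambda>\<omega>. aux_M \<omega> + aux_S (f m) (\<kappa> m) \<omega>))
                         * real (l (i m)) \<ge> x}"
        using eventually_ge_at_top[of 1] D_pos eventually_Z_ratio_ge[OF a_lim index_ratio]
      proof eventually_elim
        case (elim m)
        then have D: "0 < m - load m" by (auto simp: zero_less_divide_iff)
        have im: "i m \<in> {1..f m}" "i m \<le> p m"
          using i elim(1) min_count_le[of "f m" "\<kappa> m"] unfolding p_def by force+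
        have "p m / (m - load m) * real t \<ge> x \<longleftrightarrow> a m \<le> t" for t
        proof -
          have "p m / (m - load m) * real t \<ge> x \<longleftrightarrow> x * (m - load m) / p m \<le> t"
            using D p_pos[OF elim(1)] by (simp add: field_simps)
          also have "\<dots> \<longleftrightarrow> a m \<le> t" unfolding a_def by linarith
          finally show ?thesis .
        qed
        then show ?case
          using tail[OF elim(1) im(1), of "a m"] r_min[OF elim(1) im] elim(3)
          unfolding mean_M_S[OF elim(1)] p_def[symmetric] by simp
      qed
    qed
  qed

  \<comment> \<open>Geometric limit for the other classes\<close>
  moreover have "(\<lambda>m. measure_pmf.prob (stationary_pmf m (f m) (\<kappa> m)) {l. l (i m) = t})
              \<longlonglongrightarrow> pmf (geometric_tail_pmf (\<rho>c j)) t"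
    if j: "j \<in> {2..K}"
      and i: "\<forall>m\<ge>1. i m \<in> {min_count (f m) (\<kappa> m)<..f m} \<and> \<kappa> m (i m) = \<kappa>c m j" for j i t
  proof -
    \<comment> \<open>The point probability is the difference of the tails at \<open>t\<close> and
      \<open>Suc t\<close>.\<close>
    have "(\<lambda>m. \<rho>c j ^ t * (Z m (m - t) / Z m m) - \<rho>c j ^ Suc t * (Z m (m - Suc t) / Z m m))
        \<longlonglongrightarrow> \<rho>c j ^ t * 1 - \<rho>c j ^ Suc t * 1"
      by (intro tendsto_intros Z_ratio_fixed_shift_tendsto)
    also have "\<rho>c j ^ t * 1 - \<rho>c j ^ Suc t * 1 = pmf (geometric_tail_pmf (\<rho>c j)) t"
      using \<rho>[OF j] by (simp add: geometric_tail_pmf_def algebra_simps)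
    finally show ?thesis
    proof (rule Lim_transform_eventually)
      show "\<forall>\<^sub>F m in sequentially.
          \<rho>c j ^ t * (Z m (m - t) / Z m m) - \<rho>c j ^ Suc t * (Z m (m - Suc t) / Z m m) =
          measure_pmf.prob (stationary_pmf m (f m) (\<kappa> m)) {l. l (i m) = t}"
        using eventually_ge_at_top[of "Suc t"]
      proof eventually_elim
        case (elim m)
        then have m: "1 \<le> m" by simp
        have im: "i m \<in> {1..f m}" using i m by force
        have r: "r m (i m) = \<rho>c j"
          using i m ratios[OF m, of j] j \<kappa>1[OF m] by (simp add: r_def)
        have "{l. l (i m) = t} = {l. t \<le> l (i m)} - {l. Suc t \<le> l (i m)}" by auto
        moreover have "measure_pmf.prob (stationary_pmf m (f m) (\<kappa> m)) ({l. t \<le> l (i m)} - {l. Suc t \<le> l (i m)}) =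
            measure_pmf.prob (stationary_pmf m (f m) (\<kappa> m)) {l. t \<le> l (i m)}
            - measure_pmf.prob (stationary_pmf m (f m) (\<kappa> m)) {l. Suc t \<le> l (i m)}"
          by (rule measure_pmf.finite_measure_Diff) auto
        ultimately show ?case
          using tail[OF m im, of t] tail[OF m im, of "Suc t"] elim r by (simp only: Suc_leD)
      qed
    qed
  qed

  \<comment> \<open>Convergence in probability of the free monomers\<close>
  moreover have "(\<lambda>m. measure_pmf.prob (stationary_pmf m (f m) (\<kappa> m))
                   {l. \<bar>free_monomers m (f m) l / real m - \<kappa>bar\<bar> > \<epsilon>}) \<longlonglongrightarrow> 0"
    if \<epsilon>: "0 < \<epsilon>" for \<epsilon>
  proof (rule tendsto_sandwich[where f = "\<lambda>_. 0"])
    \<comment> \<open>\<open>V m\<close> is the second moment of \<open>M / m\<close> about the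
      limit \<open>\<kappa>bar\<close> itself, expanded by \<open>M\<^sup>2 = M (M - 1) + M\<close>
      into factorial moments. Markov's inequality for the square then finishes the argument.\<close>
    define V where "V m = (u m / m)\<^sup>2 * (Z m (m - 2) / Z m m) + u m / m * (Z m (m - 1) / Z m m) * (1 / m)
        - 2 * \<kappa>bar * (u m / m * (Z m (m - 1) / Z m m)) + \<kappa>bar\<^sup>2" for m
    have "V \<longlonglongrightarrow> \<kappa>bar\<^sup>2 * 1 + \<kappa>bar * 1 * 0 - 2 * \<kappa>bar * (\<kappa>bar * 1) + \<kappa>bar\<^sup>2"
      unfolding V_def by (intro tendsto_intros u_lim Z_ratio_fixed_shift_tendsto lim_1_over_n)
    then have "V \<longlonglongrightarrow> 0" by (simp add: power2_eq_square)
    then show "(\<lambda>m. V m / \<epsilon>\<^sup>2) \<longlonglongrightarrow> 0"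
      using tendsto_divide[OF _ tendsto_const, of V 0 _ "\<epsilon>\<^sup>2"] \<epsilon> by simp
    show "\<forall>\<^sub>F m in sequentially. measure_pmf.prob (stationary_pmf m (f m) (\<kappa> m))
                   {l. \<bar>free_monomers m (f m) l / real m - \<kappa>bar\<bar> > \<epsilon>} \<le> V m / \<epsilon>\<^sup>2"
      using eventually_ge_at_top[of 2]
    proof eventually_elim
      case (elim m)
      then have m: "1 \<le> m" by simp
      obtain N where N: "m = Suc (Suc N)" using elim by (metis add_2_eq_Suc le_Suc_ex)
      let ?P = "stationary_pmf m (f m) (\<kappa> m)" and ?M = "free_monomers m (f m)"
      have "finite (set_pmf ?P)"
        using set_stationary_pmf_subset[OF pos[OF m]] finite_configs by (rule finite_subset)
      then have int: "integrable ?P h" for h :: "_ \<Rightarrow> real" by (rule integrable_measure_pmf_finite)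
      have E1: "measure_pmf.expectation ?P ?M = u m * (Z m (m - 1) / Z m m)"
        using expectation_free_monomers(1)[of "\<kappa> m" "f m" "Suc N"] aux(1)[OF m] pos[OF m]
        unfolding u_def r_fun N by simp
      have E2: "measure_pmf.expectation ?P (\<lambda>l. ?M l * (?M l - 1)) = (u m)\<^sup>2 * (Z m (m - 2) / Z m m)"
        using expectation_free_monomers(2)[of "\<kappa> m" "f m" N] aux(1)[OF m] pos[OF m]
        unfolding u_def r_fun N by simp
      have "(?M l / m - \<kappa>bar)\<^sup>2 = ?M l * (?M l - 1) / m\<^sup>2 + ?M l * (1 / m\<^sup>2 - 2 * \<kappa>bar / m) + \<kappa>bar\<^sup>2" for l
        using m by (simp add: field_simps power2_eq_square)
      then have "measure_pmf.expectation ?P (\<lambda>l. (?M l / m - \<kappa>bar)\<^sup>2) =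
          measure_pmf.expectation ?P (\<lambda>l. ?M l * (?M l - 1)) / m\<^sup>2
          + measure_pmf.expectation ?P ?M * (1 / m\<^sup>2 - 2 * \<kappa>bar / m) + \<kappa>bar\<^sup>2"
        by (simp add: int del: right_diff_distrib)
      also have "\<dots> = V m"
        unfolding E1 E2 V_def by (simp add: algebra_simps power2_eq_square diff_divide_distrib)
      finally have V: "measure_pmf.expectation ?P (\<lambda>l. (?M l / m - \<kappa>bar)\<^sup>2) = V m" .
      have "measure_pmf.prob ?P {l. \<bar>?M l / m - \<kappa>bar\<bar> > \<epsilon>} \<le> measure_pmf.prob ?P {l. (?M l / m - \<kappa>bar)\<^sup>2 \<ge> \<epsilon>\<^sup>2}"
        using \<epsilon> by (intro measure_pmf.finite_measure_mono) (auto simp flip: abs_le_square_iff)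
      also have "\<dots> \<le> V m / \<epsilon>\<^sup>2"
        using integral_Markov_inequality_measure[OF int[of "\<lambda>l. (?M l / m - \<kappa>bar)\<^sup>2"], of "{}" "\<epsilon>\<^sup>2"] \<epsilon> V
        by simp
      finally show ?case .
    qed
  qed auto
  ultimately show ?thesis by blast
qed

end
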